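(* Let $m\ge 4$ and let $(W_n)_{n\ge 0}$ be the signed random heap process with $m$ columns, started from the empty heap. Let $\#T(W_k)$ be the number of pieces in the roof of $W_k$. Then, almost surely, $$\limsup_{n\to\infty}\frac{1}{mn}\sum_{k=1}^n \#T(W_k)\le 0.32893 .$$
   Context: Signed random heap process with $m$ columns. Columns are indexed by $\mathbb{Z}_m$ (integers mod $m$). A piece is a triple (height, column, sign) with height in $\{1,2,\dots\}$, column in $\mathbb{Z}_m$, sign in $\{+,-\}$. $W_0$ is the empty heap. Given $W_n$, let $h_j$ be the height of the highest piece in column $j$ and $s_j$ its sign, with $h_j=0$ if column $j$ is empty. A column $k\in\mathbb{Z}_m$ and sign $s\in\{+,-\}$ are chosen uniformly among the $2m$ possibilities, independently of the past, and a piece is "dropped" (it "falls") in column $k$: if $h_k>\max\{h_{k-1},h_{k+1}\}$ and $s_k\ne s$, then the new piece and the piece $(h_k,k,s_k)$ annihilate (the latter is removed and nothing is added); otherwise the piece $(\max\{h_{k-1},h_k,h_{k+1}\}+1,\,k,\,s)$ is added. The result is $W_{n+1}$. A piece of a heap is removable if there is no piece at greater height in its own column or in either of the two adjacent columns. The roof $T(W)$ of a heap $W$ is the set of its removable pieces. *)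

theory Defs
  imports "HOL-Probability.Probability"
begin

datatype sign = Plus | Minus

text \<open>A piece is (height, column, sign). Columns are the residues \<open>0, \<dots>, m - 1\<close> of \<open>\<int>\<^sub>m\<close>.\<close>

type_synonym piece = "nat \<times> nat \<times> sign"
type_synonym heap = "piece set"

definition left_col :: "nat \<Rightarrow> nat \<Rightarrow> nat" where
  "left_col m k = (k + m - 1) mod m"

definition right_col :: "nat \<Rightarrow> nat \<Rightarrow> nat" where
  "right_col m k = (k + 1) mod m"

text \<open>Real heights are at least 1, so the added 0 only matters for an empty column.\<close>

definition top_height :: "heap \<Rightarrow> nat \<Rightarrow> nat" where
  "top_height W j = Max (insert 0 {h. \<exists>s. (h, j, s) \<in> W})"

text \<open>Only meaningful for a nonempty column; a reachable heap has at most one piece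
  at any given height and column, so the description is then unique.\<close>

definition top_sign :: "heap \<Rightarrow> nat \<Rightarrow> sign" where
  "top_sign W j = (THE s. (top_height W j, j, s) \<in> W)"

definition drop_piece :: "nat \<Rightarrow> nat \<times> sign \<Rightarrow> heap \<Rightarrow> heap" where
  "drop_piece m c W =
    (let k = fst c; s = snd c;
         hl = top_height W (left_col m k); hk = top_height W k; hr = top_height W (right_col m k)
     in if hk > max hl hr \<and> top_sign W k \<noteq> s
        then W - {(hk, k, top_sign W k)}
        else insert (max hl (max hk hr) + 1, k, s) W)"

primrec heap_process :: "nat \<Rightarrow> (nat \<Rightarrow> nat \<times> sign) \<Rightarrow> nat \<Rightarrow> heap" where
  "heap_process m c 0 = {}"
| "heap_process m c (Suc n) = drop_piece m (c n) (heap_process m c n)"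

definition roof :: "nat \<Rightarrow> heap \<Rightarrow> heap" where
  "roof m W = {(h, k, s) \<in> W.
    \<not> (\<exists>h' k' s'. (h', k', s') \<in> W \<and> h' > h \<and> k' \<in> {left_col m k, k, right_col m k})}"

definition uniform_choices :: "nat \<Rightarrow> 'a measure \<Rightarrow> (nat \<Rightarrow> 'a \<Rightarrow> nat \<times> sign) \<Rightarrow> bool" where
  "uniform_choices m M c \<longleftrightarrow>
    prob_space.indep_vars M (\<lambda>_. count_space UNIV) c UNIV \<and>
    (\<forall>n. distr M (count_space UNIV) (c n) = measure_pmf (pmf_of_set ({..<m} \<times> {Plus, Minus})))"

end

theory Submission
  imports Defs
begin

text \<open>
  Let \<open>\<rho>\<close> be the fraction of columns whose top piece is in the roof. A piece dropped next to
  \<open>i\<close> roof pieces (its own column included) changes the roof by \<open>1 - i\<close>, and the mean of \<open>1 - i\<close> over all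
  columns is \<open>1 - 3 \<rho>\<close>. Whether the dropped piece is ever removed depends only on later drops, since
  the pieces above it evolve autonomously; hence it is immortal with a probability \<open>\<sigma>\<close> that does
  not depend on the heap. Now consider the heap of the immortal pieces only. Its roof is bounded, and a new
  immortal piece changes it by \<open>1 - i - x\<close>, where \<open>x\<close> counts the neighbouring immortal pieces that are
  covered by mortal pieces only. So \<open>\<sigma> (1 - 3 \<rho>)\<close> is on average equal to the rate of the extra covers
  \<open>x\<close>. These occur at least at rate \<open>\<sigma> \<rho> / 20\<close>: on average at least \<open>m \<rho> / 2\<close> roof pieces have just been covered
  from one side; when the other side is covered too, with probability at least \<open>1 / 10\<close> the first of the
  five columns involved to be hit next is the one that removes the first cover.
  This gives \<open>\<rho> \<le> 1 / 3.05 < 0.32788\<close> on average.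

  To obtain an almost sure statement, all this is done over a finite horizon \<open>N\<close>, uniformly in the
  initial heap, with "immortal" replaced by "alive at time \<open>N\<close>". Exponential moments over blocks of length
  \<open>N\<close> and the Borel-Cantelli lemma then finish the proof.
\<close>

subsection \<open>Columns on a cycle and averages over choices\<close>

locale cyclic_columns =
  fixes m :: nat
  assumes four_le_m: "4 \<le> m"
begin

abbreviation L :: "nat \<Rightarrow> nat" where "L \<equiv> left_col m"
abbreviation R :: "nat \<Rightarrow> nat" where "R \<equiv> right_col m"

lemma L_eq: "k < m \<Longrightarrow> L k = (if k = 0 then m - 1 else k - 1)"
  unfolding left_col_def by (cases k) (auto simp: mod_if)

lemma R_eq: "k < m \<Longrightarrow> R k = (if k = m - 1 then 0 else k + 1)"
  unfolding right_col_def using four_le_m by (auto simp: mod_if)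

lemma L_less [simp]: "L k < m" and R_less [simp]: "R k < m"
  using four_le_m by (auto simp: left_col_def right_col_def)

text \<open>\<open>L (L k) \<noteq> R k\<close> would fail for m = 3. \<open>L (L k)\<close> and
  \<open>R (R k)\<close> coincide for m = 4, which is why later column sets only get upper bounds on
  their cardinality.\<close>

lemma column_arith [simp]:
  assumes "k < m"
  shows "R (L k) = k" "L (R k) = k" "L k \<noteq> k" "R k \<noteq> k" "k \<noteq> L k" "k \<noteq> R k"
    "L k \<noteq> R k" "R k \<noteq> L k"
    "L (L k) \<noteq> k" "R (R k) \<noteq> k" "L (L k) \<noteq> R k" "R (R k) \<noteq> L k"
    "k \<noteq> L (L k)" "k \<noteq> R (R k)" "R k \<noteq> L (L k)" "L k \<noteq> R (R k)"
  using assms four_le_m L_less[of k] R_less[of k]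
  by (auto simp: L_eq R_eq simp del: L_less R_less split: if_splits)

lemma bij_L: "bij_betw L {..<m} {..<m}" and bij_R: "bij_betw R {..<m} {..<m}"
  by (rule bij_betwI[where g = R]; auto) (rule bij_betwI[where g = L]; auto)

section \<open>Averages over independent uniform drops\<close>

definition choices :: "(nat \<times> sign) set" where
  "choices = {..<m} \<times> {Plus, Minus}"

lemma finite_choices [simp]: "finite choices"
  by (simp add: choices_def)

lemma card_choices: "card choices = 2 * m"
  by (simp add: choices_def card_cartesian_product)

lemma mem_choices: "(k, s) \<in> choices \<longleftrightarrow> k < m"
  unfolding choices_def by (cases s) auto

lemma fst_choices: "c \<in> choices \<Longrightarrow> fst c < m"
  by (auto simp: choices_def)

definition mean :: "(nat \<times> sign \<Rightarrow> real) \<Rightarrow> real" where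
  "mean f = (\<Sum>c\<in>choices. f c) / (2 * real m)"

lemma m_pos: "0 < real m"
  using four_le_m by simp

lemma mean_const [simp]: "mean (\<lambda>_. a) = a"
  using m_pos by (simp add: mean_def card_choices)

lemma mean_mono: "(\<And>c. c \<in> choices \<Longrightarrow> f c \<le> g c) \<Longrightarrow> mean f \<le> mean g"
  unfolding mean_def by (intro divide_right_mono sum_mono) auto

lemma mean_cong: "(\<And>c. c \<in> choices \<Longrightarrow> f c = g c) \<Longrightarrow> mean f = mean g"
  unfolding mean_def by (simp cong: sum.cong)

lemma mean_add: "mean (\<lambda>c. f c + g c) = mean f + mean g"
  by (simp add: mean_def sum.distrib add_divide_distrib)

lemma mean_diff: "mean (\<lambda>c. f c - g c) = mean f - mean g"
  by (simp add: mean_def sum_subtractf diff_divide_distrib)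

lemma mean_cmult: "mean (\<lambda>c. a * f c) = a * mean f"
  by (simp add: mean_def sum_distrib_left)

lemma mean_reindex: "bij_betw \<pi> choices choices \<Longrightarrow> mean (\<lambda>c. f (\<pi> c)) = mean f"
  unfolding mean_def by (simp add: sum.reindex_bij_betw)

lemma mean_fst: "mean (\<lambda>c. f (fst c)) = (\<Sum>k<m. f k) / real m"
proof -
  have "(\<Sum>c\<in>choices. f (fst c)) = (\<Sum>k<m. \<Sum>s\<in>{Plus, Minus}. f k)"
    unfolding choices_def by (simp only: sum.cartesian_product split_def)
  also have "\<dots> = 2 * (\<Sum>k<m. f k)"
    by (simp add: sum_distrib_left)
  finally show ?thesis
    by (simp add: mean_def)
qed

text \<open>Expectation over independent uniform drops, with the first drop outermost. The recursion
  matches that of \<open>run\<close>, so one-step estimates can be iterated by induction.\<close>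

primrec avg :: "nat \<Rightarrow> ((nat \<times> sign) list \<Rightarrow> real) \<Rightarrow> real" where
  "avg 0 f = f []"
| "avg (Suc n) f = mean (\<lambda>c. avg n (\<lambda>xs. f (c # xs)))"

lemma avg_const [simp]: "avg n (\<lambda>_. a) = a"
  by (induction n) auto

lemma avg_mono:
  "(\<And>xs. length xs = n \<Longrightarrow> set xs \<subseteq> choices \<Longrightarrow> f xs \<le> g xs) \<Longrightarrow> avg n f \<le> avg n g"
  by (induction n arbitrary: f g) (auto intro!: mean_mono)

lemma avg_cong:
  "(\<And>xs. length xs = n \<Longrightarrow> set xs \<subseteq> choices \<Longrightarrow> f xs = g xs) \<Longrightarrow> avg n f = avg n g"
  by (intro antisym avg_mono) auto

lemma avg_add: "avg n (\<lambda>xs. f xs + g xs) = avg n f + avg n g"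
  by (induction n arbitrary: f g) (auto simp: mean_add)

lemma avg_diff: "avg n (\<lambda>xs. f xs - g xs) = avg n f - avg n g"
  by (induction n arbitrary: f g) (auto simp: mean_diff)

lemma avg_cmult: "avg n (\<lambda>xs. a * f xs) = a * avg n f"
  by (induction n arbitrary: f) (auto simp: mean_cmult)

lemma avg_append: "avg (n + k) f = avg n (\<lambda>xs. avg k (\<lambda>ys. f (xs @ ys)))"
  by (induction n arbitrary: f) auto

lemma avg_map:
  assumes "bij_betw \<pi> choices choices"
  shows "avg n (\<lambda>xs. f (map \<pi> xs)) = avg n f"
proof (induction n arbitrary: f)
  case (Suc n)
  have "avg (Suc n) (\<lambda>xs. f (map \<pi> xs)) = mean (\<lambda>c. avg n (\<lambda>xs. f (\<pi> c # xs)))"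
    using Suc[of "\<lambda>xs. f (_ # xs)"] by simp
  also have "\<dots> = avg (Suc n) f"
    using mean_reindex[OF assms, of "\<lambda>c. avg n (\<lambda>xs. f (c # xs))"] by simp
  finally show ?case .
qed simp

lemma avg_eq_sum:
  "avg n f = (\<Sum>xs | length xs = n \<and> set xs \<subseteq> choices. f xs) / (2 * real m) ^ n"
proof (induction n arbitrary: f)
  case 0
  have "{xs :: (nat \<times> sign) list. length xs = 0 \<and> set xs \<subseteq> choices} = {[]}"
    by auto
  then show ?case
    by simp
next
  case (Suc n)
  let ?A = "{xs. length xs = n \<and> set xs \<subseteq> choices}"
  have "{xs. length xs = Suc n \<and> set xs \<subseteq> choices} = (\<lambda>(c, xs). c # xs) ` (choices \<times> ?A)"
    by (auto simp: length_Suc_conv image_iff)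
  then have "(\<Sum>xs | length xs = Suc n \<and> set xs \<subseteq> choices. f xs)
      = (\<Sum>(c, xs)\<in>choices \<times> ?A. f (c # xs))"
    by (simp only:, subst sum.reindex) (auto simp: inj_on_def split_def)
  also have "\<dots> = (\<Sum>c\<in>choices. \<Sum>xs\<in>?A. f (c # xs))"
    by (simp add: sum.cartesian_product)
  finally show ?case
    by (simp add: Suc mean_def sum_divide_distrib mult.commute)
qed

section \<open>Strict local maxima on the cycle\<close>

definition exposed :: "(nat \<Rightarrow> nat) \<Rightarrow> nat \<Rightarrow> bool" where
  "exposed g k \<longleftrightarrow> g (L k) < g k \<and> g (R k) < g k"

definition rc :: "(nat \<Rightarrow> nat) \<Rightarrow> real" where
  "rc g = (\<Sum>k<m. of_bool (exposed g k))"

definition near :: "(nat \<Rightarrow> nat) \<Rightarrow> nat \<Rightarrow> real" where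
  "near g k = of_bool (exposed g (L k)) + of_bool (exposed g k) + of_bool (exposed g (R k))"

lemma rc_nonneg: "0 \<le> rc g" and rc_le: "rc g \<le> m"
proof -
  show "0 \<le> rc g"
    by (simp add: rc_def sum_nonneg)
  have "rc g \<le> (\<Sum>k<m. 1)"
    unfolding rc_def by (rule sum_mono) simp
  then show "rc g \<le> m"
    by simp
qed

lemma exposed_R: "k < m \<Longrightarrow> exposed g k \<Longrightarrow> \<not> exposed g (R k)"
  and exposed_L: "k < m \<Longrightarrow> exposed g k \<Longrightarrow> \<not> exposed g (L k)"
  by (auto simp: exposed_def)

lemma near_exposed: "k < m \<Longrightarrow> exposed g k \<Longrightarrow> near g k = 1"
  by (simp add: near_def exposed_L exposed_R)

lemma sum_L: "(\<Sum>k<m. f (L k)) = (\<Sum>k<m. f k)" and sum_R: "(\<Sum>k<m. f (R k)) = (\<Sum>k<m. f k)"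
  by (intro sum.reindex_bij_betw bij_L bij_R)+

lemma sum_near: "(\<Sum>k<m. near g k) = 3 * rc g"
  unfolding near_def rc_def using sum_L[of "\<lambda>k. of_bool (exposed g k) :: real"]
    sum_R[of "\<lambda>k. of_bool (exposed g k) :: real"] by (simp add: sum.distrib)

text \<open>Two adjacent columns cannot both be strict local maxima, so \<open>k\<close> and
  \<open>R k\<close> together count at most once.\<close>

lemma rc_le_half: "2 * rc g \<le> m"
proof -
  have "2 * rc g = (\<Sum>k<m. of_bool (exposed g k) + of_bool (exposed g (R k)))"
    unfolding rc_def using sum_R[of "\<lambda>k. of_bool (exposed g k) :: real"] by (simp add: sum.distrib)
  also have "\<dots> \<le> (\<Sum>k<m. 1)"
    by (rule sum_mono) (auto simp: exposed_R)
  finally show ?thesis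
    by simp
qed

lemma rc_cong: "(\<And>k. k < m \<Longrightarrow> g k = g' k) \<Longrightarrow> rc g = rc g'"
  unfolding rc_def exposed_def by (rule sum.cong) auto

text \<open>A new value above all others makes column k a strict local maximum and spoils both
  neighbours, whatever they were before. Columns outside these three are not compared with
  k.\<close>

lemma rc_update:
  assumes "k < m" "\<And>j. j < m \<Longrightarrow> g j < T"
  shows "rc (g(k := T)) = rc g + 1 - near g k"
proof -
  let ?e = "\<lambda>g k. of_bool (exposed g k) :: real"
  let ?B = "{..<m} - {L k, k, R k}"
  have split: "rc h = ?e h (L k) + ?e h k + ?e h (R k) + (\<Sum>j\<in>?B. ?e h j)" for h
  proof -
    have "rc h = (\<Sum>j\<in>{L k, k, R k}. ?e h j) + (\<Sum>j\<in>?B. ?e h j)"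
      unfolding rc_def using assms(1) by (subst sum.subset_diff[of "{L k, k, R k}"]) auto
    then show ?thesis
      using assms(1) by simp
  qed
  have "exposed (g(k := T)) j = exposed g j" if "j \<in> ?B" for j
  proof -
    from that assms(1) have "L j \<noteq> k" "R j \<noteq> k" "j \<noteq> k"
      by auto
    then show ?thesis
      by (simp add: exposed_def)
  qed
  then have "(\<Sum>j\<in>?B. ?e (g(k := T)) j) = (\<Sum>j\<in>?B. ?e g j)"
    by (intro sum.cong) auto
  moreover have "exposed (g(k := T)) k" "\<not> exposed (g(k := T)) (L k)" "\<not> exposed (g(k := T)) (R k)"
    using assms by (auto simp: exposed_def less_imp_le not_less)
  ultimately show ?thesis
    unfolding split[of g] split[of "g(k := T)"] near_def by simp
qed

end

subsection \<open>Heaps as stacks of time-stamped pieces\<close>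

type_synonym stacks = "nat \<Rightarrow> (nat \<times> sign) list"

text \<open>The value 0 of an empty column lies below every real stamp, since \<open>valid\<close>
  makes stamps positive.\<close>

definition top_stamp :: "(nat \<times> sign) list \<Rightarrow> nat" where
  "top_stamp xs = (case xs of [] \<Rightarrow> 0 | x # _ \<Rightarrow> fst x)"

lemma top_stamp_simps [simp]: "top_stamp [] = 0" "top_stamp (x # xs) = fst x"
  by (simp_all add: top_stamp_def)

lemma top_stamp_append: "top_stamp (xs @ ys) = (if xs = [] then top_stamp ys else top_stamp xs)"
  by (cases xs) auto

definition tops :: "stacks \<Rightarrow> nat \<Rightarrow> nat" where
  "tops V k = top_stamp (V k)"

context cyclic_columns
begin

text \<open>Stacks list the top piece first, and the drop at time \<open>T\<close> carries the stamp
  \<open>Suc T\<close>. In equal or adjacent columns heights are ordered like stamps, so stamps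
  decide which pieces are removable.\<close>

definition step :: "nat \<Rightarrow> stacks \<Rightarrow> nat \<times> sign \<Rightarrow> stacks" where
  "step T V c = (let k = fst c in
     if exposed (tops V) k \<and> snd (hd (V k)) \<noteq> snd c then V(k := tl (V k))
     else V(k := (Suc T, snd c) # V k))"

primrec run :: "nat \<Rightarrow> stacks \<Rightarrow> (nat \<times> sign) list \<Rightarrow> stacks" where
  "run T V [] = V"
| "run T V (c # xs) = run (Suc T) (step T V c) xs"

lemma run_append: "run T V (xs @ ys) = run (T + length xs) (run T V xs) ys"
  by (induction xs arbitrary: T V) auto

definition valid :: "nat \<Rightarrow> stacks \<Rightarrow> bool" where
  "valid T V \<longleftrightarrow> (\<forall>k<m. sorted_wrt (>) (map fst (V k)) \<and> (\<forall>x\<in>set (V k). 0 < fst x \<and> fst x \<le> T))"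

lemma validD:
  assumes "valid T V" "k < m"
  shows "sorted_wrt (>) (map fst (V k))" "x \<in> set (V k) \<Longrightarrow> 0 < fst x" "x \<in> set (V k) \<Longrightarrow> fst x \<le> T"
  using assms by (auto simp: valid_def)

lemma tops_le: "valid T V \<Longrightarrow> k < m \<Longrightarrow> tops V k \<le> T"
  using validD(3)[of T V k] by (cases "V k") (auto simp: tops_def)

lemma stamp_le_tops: "valid T V \<Longrightarrow> k < m \<Longrightarrow> x \<in> set (V k) \<Longrightarrow> fst x \<le> tops V k"
  using validD(1)[of T V k] by (cases "V k") (auto simp: tops_def)

lemma exposed_nonempty: "exposed (tops V) k \<Longrightarrow> V k \<noteq> []"
  by (auto simp: exposed_def tops_def)

lemma valid_Suc: "valid T V \<Longrightarrow> valid (Suc T) V"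
  by (auto simp: valid_def le_SucI)

lemma step_pop: "exposed (tops V) k \<Longrightarrow> snd (hd (V k)) \<noteq> s \<Longrightarrow> step T V (k, s) = V(k := tl (V k))"
  and step_push: "\<not> exposed (tops V) k \<or> snd (hd (V k)) = s \<Longrightarrow> step T V (k, s) = V(k := (Suc T, s) # V k)"
  by (auto simp: step_def)

lemma step_other: "j \<noteq> fst c \<Longrightarrow> step T V c j = V j"
  by (auto simp: step_def Let_def)

lemma valid_step:
  assumes "valid T V"
  shows "valid (Suc T) (step T V c)"
  unfolding valid_def
proof (intro allI impI)
  fix j assume j: "j < m"
  note v = validD[OF assms j]
  have "V j = hd (V j) # tl (V j)" if "V j \<noteq> []"
    using that by simp
  then have tl: "sorted_wrt (>) (map fst (tl (V j)))" "set (tl (V j)) \<subseteq> set (V j)"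
    using v(1) by (cases "V j"; auto)+
  have "step T V c j = V j \<or> step T V c j = tl (V j) \<or> (\<exists>s. step T V c j = (Suc T, s) # V j)"
    by (auto simp: step_def Let_def)
  then show "sorted_wrt (>) (map fst (step T V c j)) \<and>
      (\<forall>x\<in>set (step T V c j). 0 < fst x \<and> fst x \<le> Suc T)"
    using v tl by (auto simp: le_imp_less_Suc le_SucI)
qed

lemma set_step: "set (step T V c j) \<subseteq> insert (Suc T, snd c) (set (V j))"
  using list.set_sel(2)[of "V j"] by (cases "V j") (auto simp: step_def Let_def)

text \<open>Later drops only bring in stamps above \<open>T\<close>. In particular a removed piece
  cannot reappear.\<close>

lemma run_old_stamps:
  assumes "x \<in> set (run T V xs j)" "fst x \<le> T"
  shows "x \<in> set (V j)"
  using assms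
proof (induction xs arbitrary: T V)
  case (Cons c xs)
  then have "x \<in> set (step T V c j)"
    by simp
  then show ?case
    using set_step[of T V c j] Cons.prems(2) by auto
qed simp

lemma valid_run: "valid T V \<Longrightarrow> valid (T + length xs) (run T V xs)"
  by (induction xs arbitrary: T V) (use valid_step in fastforce)+

text \<open>Only the top of an exposed column is ever removed, and its stamp exceeds those in the
  adjacent columns. Hence x is protected as long as the later piece y is present.\<close>

lemma covered_survives:
  assumes "valid T V" "i < m" "k \<in> {L i, i, R i}" "y \<in> set (V k)" "x \<in> set (V i)" "fst x < fst y"
    and "y \<in> set (run T V xs k)"
  shows "x \<in> set (run T V xs i)"
  using assms
proof (induction xs arbitrary: T V)
  case (Cons c xs)
  let ?V = "step T V c"
  have k: "k < m"
    using Cons.prems(2,3) by auto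
  have yT: "fst y \<le> T"
    using validD(3)[OF Cons.prems(1) k Cons.prems(4)] .
  have y: "y \<in> set (?V k)"
    using run_old_stamps[of y "Suc T" ?V xs k] Cons.prems(7) yT by simp
  have "x \<in> set (?V i)"
  proof (cases "?V i = tl (V i) \<and> exposed (tops V) i \<and> i = fst c")
    case True
    have "tops V k \<le> tops V i"
      using True Cons.prems(3) by (auto simp: exposed_def)
    then have "fst x < tops V i"
      using stamp_le_tops[OF Cons.prems(1) k Cons.prems(4)] Cons.prems(6) by linarith
    then show ?thesis
      using Cons.prems(5) True by (cases "V i") (auto simp: tops_def)
  next
    case False
    then show ?thesis
      using Cons.prems(5) by (auto simp: step_def Let_def split: if_splits)
  qed
  then show ?case
    using Cons.IH[OF valid_step[OF Cons.prems(1)] Cons.prems(2,3) y] Cons.prems(6,7) by simp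
qed simp

text \<open>Applied to the final stacks this gives the top pieces of the heap of those pieces that are
  present at time \<open>T\<close> and still there at the end.\<close>

definition old_top :: "nat \<Rightarrow> stacks \<Rightarrow> nat \<Rightarrow> nat" where
  "old_top T V k = Max (insert 0 {t \<in> fst ` set (V k). t \<le> T})"

lemma old_top_le: "old_top T V k \<le> T"
  unfolding old_top_def by (subst Max_le_iff) auto

lemma le_old_top: "x \<in> set (V k) \<Longrightarrow> fst x \<le> T \<Longrightarrow> fst x \<le> old_top T V k"
  unfolding old_top_def by (intro Max_ge) auto

lemma old_top_leI: "(\<And>x. x \<in> set (V k) \<Longrightarrow> fst x \<le> T \<Longrightarrow> fst x \<le> b) \<Longrightarrow> old_top T V k \<le> b"
  unfolding old_top_def by (subst Max_le_iff) auto

lemma old_top_run_le: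
  assumes "valid T V" "k < m"
  shows "old_top T (run T V xs) k \<le> tops V k"
  by (intro old_top_leI stamp_le_tops[OF assms]) (auto dest: run_old_stamps)

text \<open>Both sides look at the same final stacks. Raising the cutoff by one can only add the
  piece of the drop \<open>c\<close>, which then has the largest stamp counted.\<close>

lemma old_top_Suc:
  fixes c :: "nat \<times> sign" and xs :: "(nat \<times> sign) list"
  assumes "valid T V" "k < m" "fst c < m"
  defines "Vf \<equiv> run (Suc T) (step T V c) xs"
  shows "old_top (Suc T) Vf k =
    (if k = fst c \<and> Suc T \<in> fst ` set (Vf k) then Suc T else old_top T Vf k)"
proof (cases "Suc T \<in> fst ` set (Vf k)")
  case True
  then have "Suc T \<in> fst ` set (step T V c k)"
    unfolding Vf_def by (auto dest: run_old_stamps)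
  then have "k = fst c"
    using step_other[of k c T V] validD(3)[OF assms(1,2)] by fastforce
  moreover have "old_top (Suc T) Vf k = Suc T"
    using True le_old_top[of _ Vf k "Suc T"] old_top_le[of "Suc T" Vf k] by fastforce
  ultimately show ?thesis
    using True by simp
next
  case False
  then have "{t \<in> fst ` set (Vf k). t \<le> Suc T} = {t \<in> fst ` set (Vf k). t \<le> T}"
    by (force simp: le_Suc_eq)
  then show ?thesis
    using False by (simp add: old_top_def)
qed

text \<open>A new piece that lasts to the end protects what lies beneath it, by
  \<open>covered_survives\<close>.\<close>

lemma tops_le_old_top:
  fixes s :: sign and xs :: "(nat \<times> sign) list"
  assumes "valid T V" "k < m" "i \<in> {L k, k, R k}" "V i \<noteq> []"
    and "\<not> exposed (tops V) k \<or> snd (hd (V k)) = s"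
  defines "Vf \<equiv> run (Suc T) (step T V (k, s)) xs"
  assumes "Suc T \<in> fst ` set (Vf k)"
  shows "tops V i \<le> old_top T Vf i"
proof -
  have i: "i < m" and k': "k \<in> {L i, i, R i}"
    using assms(2,3) by auto
  have V: "step T V (k, s) = V(k := (Suc T, s) # V k)"
    using assms(5) by (rule step_push)
  obtain x where x: "x \<in> set (V i)" "fst x = tops V i"
    using assms(4) by (cases "V i") (auto simp: tops_def)
  obtain y where y: "y \<in> set (Vf k)" "fst y = Suc T"
    using assms(7) by auto
  then have y': "y \<in> set (step T V (k, s) k)"
    unfolding Vf_def by (auto dest: run_old_stamps)
  have x': "x \<in> set (step T V (k, s) i)"
    using x unfolding V by auto
  have xT: "fst x \<le> T"
    using x validD(3)[OF assms(1) i] by blast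
  have "x \<in> set (Vf i)"
    unfolding Vf_def
    by (rule covered_survives[OF valid_step[OF assms(1)] i k' y' x' _ y(1)[unfolded Vf_def]])
      (use xT y in simp)
  then show ?thesis
    using le_old_top xT x(2) by metis
qed

text \<open>The top of column i survives, while the surviving tops of its neighbours are at most the
  current ones, so the strict maximum is kept.\<close>

lemma exposed_old_top:
  fixes s :: sign and xs :: "(nat \<times> sign) list"
  assumes "valid T V" "k < m" "i \<in> {L k, k, R k}" "exposed (tops V) i"
    and "\<not> exposed (tops V) k \<or> snd (hd (V k)) = s"
  defines "Vf \<equiv> run (Suc T) (step T V (k, s)) xs"
  assumes "Suc T \<in> fst ` set (Vf k)"
  shows "exposed (old_top T Vf) i"
proof -
  have "tops V i \<le> old_top T Vf i"
    unfolding Vf_def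
    by (rule tops_le_old_top[OF assms(1-3) exposed_nonempty[OF assms(4)] assms(5) assms(7)[unfolded Vf_def]])
  moreover have "old_top T Vf j \<le> tops V j" if "j < m" for j
    using old_top_run_le[OF assms(1) that, of "(k, s) # xs"] by (simp add: Vf_def)
  ultimately show ?thesis
    using assms(4) L_less[of i] R_less[of i] unfolding exposed_def by (meson le_less_trans less_le_trans)
qed

text \<open>The last two indicators are the extra covers: neighbours in the roof of the surviving
  pieces that are hidden in the full heap. Visible neighbours are in the surviving roof as well by
  \<open>exposed_old_top\<close>, and \<open>rc_update\<close> charges for both kinds.\<close>

lemma rc_old_top_step:
  assumes "valid T V" "k < m"
  defines "Vf s xs \<equiv> run (Suc T) (step T V (k, s)) xs"
  shows "rc (old_top (Suc T) (Vf s xs)) - rc (old_top T (Vf s xs)) \<le>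
    of_bool (Suc T \<in> fst ` set (Vf s xs k)) * (1 - near (tops V) k
      - (of_bool (\<not> exposed (tops V) (L k) \<and> exposed (old_top T (Vf s xs)) (L k))
        + of_bool (\<not> exposed (tops V) (R k) \<and> exposed (old_top T (Vf s xs)) (R k))))"
proof (cases "Suc T \<in> fst ` set (Vf s xs k)")
  case True
  let ?g = "old_top T (Vf s xs)"
  \<comment> \<open>The stamp \<open>Suc T\<close> arises only from a push; an annihilating drop
    creates no piece.\<close>
  have st: "\<not> exposed (tops V) k \<or> snd (hd (V k)) = s"
  proof (rule ccontr)
    assume "\<not> ?thesis"
    then have "step T V (k, s) k = tl (V k)"
      by (simp add: step_pop)
    moreover have "Suc T \<in> fst ` set (step T V (k, s) k)"
      using True unfolding Vf_def by (auto dest: run_old_stamps)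
    ultimately show False
      using validD(3)[OF assms(1,2)] by (cases "V k") fastforce+
  qed
  have ex: "exposed ?g i" if "i \<in> {L k, k, R k}" "exposed (tops V) i" for i
    using exposed_old_top[OF assms(1,2) that st] True unfolding Vf_def by blast
  have "rc (old_top (Suc T) (Vf s xs)) = rc (?g(k := Suc T))"
    using old_top_Suc[OF assms(1), where c = "(k, s)" and xs = xs] True assms(2)
    by (intro rc_cong) (auto simp: Vf_def)
  also have "\<dots> = rc ?g + 1 - near ?g k"
    using assms(2) old_top_le by (intro rc_update) (auto simp: le_imp_less_Suc)
  finally show ?thesis
    using True ex assms(2) by (auto simp: near_def)
next
  case False
  have "rc (old_top (Suc T) (Vf s xs)) = rc (old_top T (Vf s xs))"
    using old_top_Suc[OF assms(1), where c = "(k, s)" and xs = xs] False assms(2)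
    by (intro rc_cong) (auto simp: Vf_def)
  then show ?thesis
    using False by simp
qed

subsection \<open>Survival of a piece\<close>

text \<open>The pieces lying above a fixed piece, together with that piece, evolve autonomously:
  a drop matters only if it lands next to one of them.\<close>

definition above_step :: "nat \<Rightarrow> stacks \<Rightarrow> nat \<times> sign \<Rightarrow> stacks" where
  "above_step T U c =
    (if U (L (fst c)) = [] \<and> U (fst c) = [] \<and> U (R (fst c)) = [] then U else step T U c)"

text \<open>The observed piece is the bottom of column 0. Nonemptiness is tested at every time
  because an emptied column could fill up again.\<close>

primrec survives :: "nat \<Rightarrow> stacks \<Rightarrow> (nat \<times> sign) list \<Rightarrow> bool" where
  "survives T U [] \<longleftrightarrow> U 0 \<noteq> []"
| "survives T U (c # xs) \<longleftrightarrow> U 0 \<noteq> [] \<and> survives (Suc T) (above_step T U c) xs"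

text \<open>The normal form of an observed piece, reached by rotating the columns and flipping the
  signs.\<close>

definition single :: stacks where
  "single = (\<lambda>_. [])(0 := [(1, Plus)])"

definition surv_prob :: "nat \<Rightarrow> real" where
  "surv_prob N = avg N (\<lambda>xs. of_bool (survives 1 single xs))"

section \<open>Symmetries of the drops and the coupling\<close>

definition shift :: "nat \<Rightarrow> nat \<Rightarrow> nat" where
  "shift k j = (j + m - k) mod m"

definition rel_sign :: "sign \<Rightarrow> sign \<Rightarrow> sign" where
  "rel_sign s z = (if s = z then Plus else Minus)"

lemma rel_sign_simps [simp]: "rel_sign s (rel_sign s z) = z" "rel_sign s s = Plus" "rel_sign s Plus = s"
    "rel_sign s z = rel_sign s z' \<longleftrightarrow> z = z'"
  by (cases s; cases z; cases z'; simp add: rel_sign_def)+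

lemma rel_sign_eq_iff: "rel_sign s z = z' \<longleftrightarrow> z = rel_sign s z'"
  by (cases s; cases z; cases z'; simp add: rel_sign_def)

lemma shift_eq: "k < m \<Longrightarrow> j < m \<Longrightarrow> shift k j = (if k \<le> j then j - k else j + m - k)"
  unfolding shift_def by (auto simp: mod_if)

lemma shift_less [simp]: "shift k j < m"
  using four_le_m by (simp add: shift_def)

lemma shift_self [simp]: "k < m \<Longrightarrow> shift k k = 0"
  by (simp add: shift_eq)

lemma shift_inject: "k < m \<Longrightarrow> i < m \<Longrightarrow> j < m \<Longrightarrow> shift k i = shift k j \<longleftrightarrow> i = j"
  by (auto simp: shift_eq)

lemma shift_eq_0_iff: "k < m \<Longrightarrow> j < m \<Longrightarrow> shift k j = 0 \<longleftrightarrow> j = k"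
  using shift_inject[of k j k] by simp

lemma shift_L: "k < m \<Longrightarrow> j < m \<Longrightarrow> shift k (L j) = L (shift k j)"
  and shift_R: "k < m \<Longrightarrow> j < m \<Longrightarrow> shift k (R j) = R (shift k j)"
  using four_le_m L_less[of j] R_less[of j] shift_less[of k j]
  by (auto simp: shift_eq L_eq R_eq simp del: L_less R_less shift_less split: if_splits)

definition relative :: "nat \<Rightarrow> sign \<Rightarrow> nat \<times> sign \<Rightarrow> nat \<times> sign" where
  "relative k s c = (shift k (fst c), rel_sign s (snd c))"

lemma bij_relative: "k < m \<Longrightarrow> bij_betw (relative k s) choices choices"
proof -
  assume k: "k < m"
  have inj: "inj_on (relative k s) choices"
    using k by (auto simp: inj_on_def relative_def shift_inject choices_def)
  moreover have "relative k s ` choices \<subseteq> choices"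
    using k by (auto simp: relative_def mem_choices)
  ultimately show ?thesis
    unfolding bij_betw_def by (metis endo_inj_surj finite_choices)
qed

text \<open>Stacks \<open>V\<close> are coupled with the stacks \<open>U\<close> of the pieces above the piece with stamp \<open>p\<close> in
  column \<open>k\<close>: columns and signs of \<open>U\<close> are relative to \<open>(k, s)\<close>, and stamps agree up to an
  order isomorphism \<open>\<theta>\<close>.\<close>

definition coupling :: "nat \<Rightarrow> sign \<Rightarrow> nat \<Rightarrow> nat \<Rightarrow> stacks \<Rightarrow> nat \<Rightarrow> stacks \<Rightarrow> (nat \<Rightarrow> nat) \<Rightarrow> stacks \<Rightarrow> bool" where
  "coupling k s p T V T' U \<theta> rest \<longleftrightarrow>
     strict_mono_on {..T'} \<theta> \<and> \<theta> T' \<le> T \<and> \<theta> 1 = p \<and> valid T V \<and> valid T' U \<and>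
     (\<forall>j<m. V j = map (\<lambda>x. (\<theta> (fst x), rel_sign s (snd x))) (U (shift k j)) @ rest j) \<and>
     (\<forall>j<m. \<forall>i\<in>{L j, j, R j}. \<forall>u\<in>set (U (shift k i)). \<forall>v\<in>set (rest j). fst v < \<theta> (fst u)) \<and>
     U 0 \<noteq> [] \<and> last (U 0) = (1, Plus)"

text \<open>Next to a piece of U, every piece of \<open>rest\<close> in an equal or adjacent column
  has a smaller stamp, and comparisons within U are preserved by \<theta>. So the exposure test has
  the same outcome in both systems.\<close>

lemma coupling_exposed:
  assumes c: "coupling k s p T V T' U \<theta> rest" and k: "k < m" and j: "j < m"
    and ne: "\<not> (U (L (shift k j)) = [] \<and> U (shift k j) = [] \<and> U (R (shift k j)) = [])"
  shows "exposed (tops V) j \<longleftrightarrow> exposed (tops U) (shift k j)"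
proof -
  have mono: "strict_mono_on {..T'} \<theta>" and vU: "valid T' U"
    and V: "\<And>j. j < m \<Longrightarrow> V j = map (\<lambda>x. (\<theta> (fst x), rel_sign s (snd x))) (U (shift k j)) @ rest j"
    and rest: "\<And>j i u v. j < m \<Longrightarrow> i \<in> {L j, j, R j} \<Longrightarrow> u \<in> set (U (shift k i)) \<Longrightarrow> v \<in> set (rest j) \<Longrightarrow> fst v < \<theta> (fst u)"
    using c unfolding coupling_def by blast+
  have ths: "\<theta> a < \<theta> b \<longleftrightarrow> a < b" if "a \<le> T'" "b \<le> T'" for a b
    using strict_mono_on_less[OF mono, of a b] that by simp
  have tV: "tops V i = (if U (shift k i) = [] then top_stamp (rest i) else \<theta> (tops U (shift k i)))"
    if "i < m" for i
    using V[OF that] by (cases "U (shift k i)") (auto simp: tops_def top_stamp_append)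
  have top_in: "\<exists>u\<in>set (U i). tops U i = fst u" if "U i \<noteq> []" for i
    using that by (cases "U i") (auto simp: tops_def)
  have pos: "0 < tops U i" "tops U i \<le> T'" if "U i \<noteq> []" "i < m" for i
    using top_in[OF that(1)] validD[OF vU that(2)] by auto
  have lt: "top_stamp (rest i) < \<theta> (tops U (shift k i'))" 
    if lt1: "i < m" and lt2: "i' \<in> {L i, i, R i}" and lt3: "U (shift k i') \<noteq> []" for i i'
  proof (cases "rest i")
    case Nil
    \<comment> \<open>An empty \<open>rest i\<close> has top stamp 0; strict monotonicity from 0
      onwards makes the other side positive.\<close>
    have "\<theta> 0 < \<theta> (tops U (shift k i'))"
      using pos[OF lt3] ths by simp
    then show ?thesis
      using Nil by simp
  next
    case (Cons v vs)
    obtain u where "u \<in> set (U (shift k i'))" "tops U (shift k i') = fst u"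
      using top_in[OF lt3] by blast
    then show ?thesis
      using rest[OF lt1 lt2, of u v] Cons by simp
  qed
  show ?thesis
  proof (cases "U (shift k j) = []")
    case True
    then obtain i where i: "i \<in> {L j, R j}" "U (shift k i) \<noteq> []"
      using ne True shift_L[OF k j] shift_R[OF k j] by (metis insertCI)
    then have "tops V j < tops V i"
      using lt[of j i] True j tV[of j] tV[of i] by auto
    then have "\<not> exposed (tops V) j"
      using i by (auto simp: exposed_def)
    moreover have "\<not> exposed (tops U) (shift k j)"
      using True by (simp add: exposed_def tops_def)
    ultimately show ?thesis
      by simp
  next
    case False
    have "tops V i < tops V j \<longleftrightarrow> tops U (shift k i) < tops U (shift k j)" if "i \<in> {L j, R j}" for i
    proof (cases "U (shift k i) = []")
      case True
      then show ?thesis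
        using lt[of i j] that j tV[of i] tV[of j] False pos(1)[OF False]
        by (auto simp: tops_def[of U "shift k i"])
    next
      case ne': False
      then show ?thesis
        using that j tV[of i] tV[of j] False pos[OF False] pos[OF ne'] ths by auto
    qed
    then show ?thesis
      using k j by (auto simp: exposed_def shift_L shift_R)
  qed
qed

text \<open>A drop away from U changes only \<open>rest\<close>; a drop next to U is a pop or a push
  in both systems at once. The coupling ends only when the observed piece is removed, which happens
  simultaneously.\<close>

lemma coupling_step:
  assumes c: "coupling k s p T V T' U \<theta> rest" and k: "k < m" and j: "fst c < m"
  defines "V' \<equiv> step T V c" and "U' \<equiv> above_step T' U (relative k s c)"
  shows "(U' 0 \<noteq> [] \<and> (\<exists>\<theta> rest. coupling k s p (Suc T) V' (Suc T') U' \<theta> rest)) \<or>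
    (U' 0 = [] \<and> p \<notin> fst ` set (V' k))"
proof -
  obtain j z where cj: "c = (j, z)" and j: "j < m"
    using j by (cases c) auto
  have mono: "strict_mono_on {..T'} \<theta>" and thT: "\<theta> T' \<le> T" and p: "\<theta> 1 = p"
    and vV: "valid T V" and vU: "valid T' U"
    and V: "\<And>j. j < m \<Longrightarrow> V j = map (\<lambda>x. (\<theta> (fst x), rel_sign s (snd x))) (U (shift k j)) @ rest j"
    and rest: "\<And>j i u v. j < m \<Longrightarrow> i \<in> {L j, j, R j} \<Longrightarrow> u \<in> set (U (shift k i)) \<Longrightarrow> v \<in> set (rest j) \<Longrightarrow> fst v < \<theta> (fst u)"
    and U0: "U 0 \<noteq> []" and lst: "last (U 0) = (1, Plus)"
    using c unfolding coupling_def by blast+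
  have one: "(1, Plus) \<in> set (U 0)"
    using U0 lst by (metis last_in_set)
  have T'1: "1 \<le> T'"
    using validD(3)[OF vU _ one] four_le_m by simp
  have vV': "valid (Suc T) V'"
    unfolding V'_def by (rule valid_step[OF vV])
  have vU': "valid (Suc T') U'"
    unfolding U'_def above_step_def using valid_step[OF vU] valid_Suc[OF vU] by simp
  \<comment> \<open>Both clocks advance at every drop, even one that U ignores, so the next stamps
    are matched with each other.\<close>
  define \<theta>' where "\<theta>' = \<theta>(Suc T' := Suc T)"
  have th_le: "\<theta> a \<le> T" if "a \<le> T'" for a
    using strict_mono_on_leD[OF mono, of a T'] that thT by simp
  have mono': "strict_mono_on {..Suc T'} \<theta>'"
    using mono th_le unfolding \<theta>'_def strict_mono_on_def
    by (auto simp: le_Suc_eq le_imp_less_Suc)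
  have th': "\<theta>' (fst u) = \<theta> (fst u)" if "u \<in> set (U i)" "i < m" for u i
    using validD(3)[OF vU that(2,1)] by (simp add: \<theta>'_def)
  have map': "map (\<lambda>x. (\<theta>' (fst x), rel_sign s (snd x))) (U i) = map (\<lambda>x. (\<theta> (fst x), rel_sign s (snd x))) (U i)"
    if "i < m" for i
    using th'[OF _ that] by simp
  have p': "\<theta>' 1 = p" "\<theta>' (Suc T') = Suc T"
    using p T'1 by (simp_all add: \<theta>'_def)
  have inj: "shift k i = shift k j \<longleftrightarrow> i = j" if "i < m" for i
    using shift_inject[OF k that j] .
  let ?j = "shift k j"
  have relc: "relative k s c = (?j, rel_sign s z)"
    by (simp add: relative_def cj)
  have intro: "coupling k s p (Suc T) V' (Suc T') U' \<theta>' rest'"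
    if "\<And>j. j < m \<Longrightarrow> V' j = map (\<lambda>x. (\<theta>' (fst x), rel_sign s (snd x))) (U' (shift k j)) @ rest' j"
      "\<And>j i u v. j < m \<Longrightarrow> i \<in> {L j, j, R j} \<Longrightarrow> u \<in> set (U' (shift k i)) \<Longrightarrow> v \<in> set (rest' j) \<Longrightarrow> fst v < \<theta>' (fst u)"
      "U' 0 \<noteq> []" "last (U' 0) = (1, Plus)" for rest'
  proof -
    have "\<theta>' (Suc T') \<le> Suc T"
      using p' by simp
    then show ?thesis
      unfolding coupling_def using mono' p' vV' vU' that by blast
  qed
  show ?thesis
  proof (cases "U (L ?j) = [] \<and> U ?j = [] \<and> U (R ?j) = []")
    case True
    then have U': "U' = U"
      by (simp add: U'_def above_step_def relc)
    have emp: "U (shift k i) = []" if "i \<in> {L j, j, R j}" for i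
      using that True k j by (auto simp: shift_L shift_R)
    \<comment> \<open>No piece of U lies in column j or next to it, so the order condition on
      \<open>rest j\<close> is vacuous and its new content may be arbitrary.\<close>
    let ?rest = "rest(j := V' j)"
    have "coupling k s p (Suc T) V' (Suc T') U' \<theta>' ?rest"
    proof (rule intro)
      fix i assume i: "i < m"
      show "V' i = map (\<lambda>x. (\<theta>' (fst x), rel_sign s (snd x))) (U' (shift k i)) @ ?rest i"
        using V[OF i] map'[of "shift k i"] emp[of j] step_other[of i c T V]
        by (auto simp: U' cj V'_def)
    next
      fix i i' u v assume *: "i < m" "i' \<in> {L i, i, R i}" "u \<in> set (U' (shift k i'))" "v \<in> set (?rest i)"
      then have "i \<noteq> j"
        using emp[of i'] by (auto simp: U')
      then show "fst v < \<theta>' (fst u)"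
        using * rest[of i i' u v] th'[of u "shift k i'"] by (simp add: U')
    qed (use U0 lst U' in auto)
    then show ?thesis
      using U0 U' by blast
  next
    case False
    then have U': "U' = step T' U (?j, rel_sign s z)"
      unfolding U'_def above_step_def relc fst_conv by (rule if_not_P)
    have ex: "exposed (tops V) j \<longleftrightarrow> exposed (tops U) ?j"
      by (rule coupling_exposed[OF c k j False])
    have ne: "U ?j \<noteq> []" if "exposed (tops U) ?j"
      using exposed_nonempty[OF that] .
    have sg: "snd (hd (V j)) = z \<longleftrightarrow> snd (hd (U ?j)) = rel_sign s z" if "U ?j \<noteq> []"
      using V[OF j] that by (cases "U ?j") (auto simp: rel_sign_eq_iff)
    show ?thesis
    proof (cases "exposed (tops V) j \<and> snd (hd (V j)) \<noteq> z")
      case True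
      then have V'2: "V' = V(j := tl (V j))" and U'2: "U' = U(?j := tl (U ?j))"
        unfolding V'_def U' cj using ex ne sg by (auto intro!: step_pop)
      have Uj: "U ?j \<noteq> []"
        using True ex ne by blast
      have sub: "set (U' i) \<subseteq> set (U i)" for i
        by (cases "U i") (auto simp: U'2)
      have V'j: "V' i = map (\<lambda>x. (\<theta> (fst x), rel_sign s (snd x))) (U' (shift k i)) @ rest i" if "i < m" for i
        using V[OF that] Uj inj[OF that] by (auto simp: V'2 U'2 map_tl tl_append2)
      have map'': "map (\<lambda>x. (\<theta>' (fst x), rel_sign s (snd x))) (U' i) = map (\<lambda>x. (\<theta> (fst x), rel_sign s (snd x))) (U' i)"
        if "i < m" for i
        using th'[OF _ that] sub[of i] by auto
      show ?thesis
      proof (cases "U' 0 = []")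
        case True
        \<comment> \<open>What remains in column k lay below the observed piece and has stamps
          smaller than p.\<close>
        have "V' k = rest k"
          using V'j[OF k] True k by simp
        moreover have "fst v < p" if "v \<in> set (rest k)" for v
          using rest[OF k _ _ that, of k "(1, Plus)"] one p k by simp
        ultimately show ?thesis
          using True by fastforce
      next
        case False
        have "coupling k s p (Suc T) V' (Suc T') U' \<theta>' rest"
        proof (rule intro)
          fix i assume i: "i < m"
          show "V' i = map (\<lambda>x. (\<theta>' (fst x), rel_sign s (snd x))) (U' (shift k i)) @ rest i"
            using V'j[OF i] map''[of "shift k i"] by simp
        next
          fix i i' u v assume *: "i < m" "i' \<in> {L i, i, R i}" "u \<in> set (U' (shift k i'))" "v \<in> set (rest i)"
          moreover have "u \<in> set (U (shift k i'))"
            using *(3) sub by blast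
          ultimately show "fst v < \<theta>' (fst u)"
            using rest[of i i' u v] th'[of u "shift k i'"] by auto
        next
          show "last (U' 0) = (1, Plus)"
            using False lst by (auto simp: U'2 last_tl)
        qed (rule False)
        then show ?thesis
          using False by blast
      qed
    next
      case False
      then have V'2: "V' = V(j := (Suc T, z) # V j)" and U'2: "U' = U(?j := (Suc T', rel_sign s z) # U ?j)"
        unfolding V'_def U' cj using ex ne sg by (auto intro!: step_push)
      have "coupling k s p (Suc T) V' (Suc T') U' \<theta>' rest"
      proof (rule intro)
        fix i assume i: "i < m"
        show "V' i = map (\<lambda>x. (\<theta>' (fst x), rel_sign s (snd x))) (U' (shift k i)) @ rest i"
          using V[OF i] map'[of "shift k i"] inj[OF i] p' by (auto simp: V'2 U'2)
      next
        fix i i' u v assume *: "i < m" "i' \<in> {L i, i, R i}" "u \<in> set (U' (shift k i'))" "v \<in> set (rest i)"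
        show "fst v < \<theta>' (fst u)"
        proof (cases "u \<in> set (U (shift k i'))")
          case True
          then show ?thesis
            using * rest[of i i' u v] th'[of u "shift k i'"] by auto
        next
          case False
          then have "u = (Suc T', rel_sign s z)"
            using *(3) by (auto simp: U'2 split: if_splits)
          moreover have "v \<in> set (V i)"
            using V[OF *(1)] *(4) by simp
          ultimately show ?thesis
            using validD(3)[OF vV *(1)] p' by fastforce
        qed
      qed (use U0 lst in \<open>auto simp: U'2\<close>)
      moreover have "U' 0 \<noteq> []"
        using U0 by (auto simp: U'2)
      ultimately show ?thesis
        by blast
    qed
  qed
qed

lemma coupling_survives:
  assumes "coupling k s p T V T' U \<theta> rest" "k < m" "\<forall>c\<in>set xs. fst c < m"
  shows "p \<in> fst ` set (run T V xs k) \<longleftrightarrow> survives T' U (map (relative k s) xs)"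
  using assms
proof (induction xs arbitrary: T V T' U \<theta> rest)
  case Nil
  have "(1, Plus) \<in> set (U 0)" "\<theta> 1 = p" and V: "V k = map (\<lambda>x. (\<theta> (fst x), rel_sign s (snd x))) (U (shift k k)) @ rest k"
    using Nil unfolding coupling_def by (metis last_in_set, blast+)
  then have "p \<in> fst ` set (V k)"
    using Nil(2) by (force simp: V)
  then show ?case
    using Nil by (simp add: coupling_def)
next
  case (Cons c xs)
  have c: "fst c < m" "\<forall>c\<in>set xs. fst c < m"
    using Cons.prems(3) by auto
  let ?V = "step T V c" and ?U = "above_step T' U (relative k s c)"
  have U0: "U 0 \<noteq> []"
    using Cons.prems(1) by (simp add: coupling_def)
  \<comment> \<open>Since p is an old stamp, \<open>run_old_stamps\<close> excludes its return after
    a removal.\<close>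
  have pT: "p \<le> T"
  proof -
    have "(1, Plus) \<in> set (U 0)" "valid T' U"
      using Cons.prems(1) unfolding coupling_def by (metis last_in_set, blast)
    then have "1 \<le> T'"
      using validD(3)[of T' U 0] four_le_m by fastforce
    then show ?thesis
      using Cons.prems(1) strict_mono_on_leD[of "{..T'}" \<theta> 1 T'] by (auto simp: coupling_def)
  qed
  from coupling_step[OF Cons.prems(1,2) c(1)] show ?case
  proof (elim disjE conjE exE)
    fix \<theta> rest
    assume "coupling k s p (Suc T) ?V (Suc T') ?U \<theta> rest"
    from Cons.IH[OF this Cons.prems(2) c(2)] show ?thesis
      using U0 by simp
  next
    assume *: "?U 0 = []" "p \<notin> fst ` set (?V k)"
    have "p \<notin> fst ` set (run (Suc T) ?V xs k)"
      using *(2) pT by (auto dest!: run_old_stamps)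
    moreover have "\<not> survives (Suc T') ?U ys" for ys
      using *(1) by (cases ys) auto
    ultimately show ?thesis
      by simp
  qed
qed

text \<open>U starts with the top of an exposed column and everything else goes into
  \<open>rest\<close>; exposure supplies the order condition between them.\<close>

lemma coupling_init:
  assumes "valid T V" "k < m" "exposed (tops V) k"
  shows "coupling k (snd (hd (V k))) (tops V k) T V 1 single
    (\<lambda>x. if x = 0 then 0 else tops V k) (V(k := tl (V k)))"
proof -
  have ne: "V k \<noteq> []"
    using exposed_nonempty[OF assms(3)] .
  have shk: "shift k j = 0 \<longleftrightarrow> j = k" if "j < m" for j
    using shift_eq_0_iff[OF assms(2) that] .
  have pos: "0 < tops V k"
    using assms(3) by (auto simp: exposed_def)
  have V: "V j = map (\<lambda>x. (if fst x = 0 then 0 else tops V k, rel_sign (snd (hd (V k))) (snd x)))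
      (single (shift k j)) @ (V(k := tl (V k))) j" if "j < m" for j
    using ne shk[OF that] by (cases "V k") (auto simp: single_def tops_def)
  have lt: "fst v < tops V k" if "j < m" "i \<in> {L j, j, R j}" "u \<in> set (single (shift k i))"
    "v \<in> set ((V(k := tl (V k))) j)" for i j u v
  proof -
    have "i < m"
      using that(1,2) by auto
    then have "i = k"
      using that(3) shk[of i] by (auto simp: single_def split: if_splits)
    then have j: "j \<in> {L k, k, R k}"
      using that(1,2) by auto
    show ?thesis
    proof (cases "j = k")
      case True
      then show ?thesis
        using that(4) ne validD(1)[OF assms(1,2)] by (cases "V k") (auto simp: tops_def)
    next
      case False
      then have "fst v \<le> tops V j"
        using stamp_le_tops[OF assms(1) that(1)] that(4) by simp
      then show ?thesis
        using assms(3) j False by (auto simp: exposed_def)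
    qed
  qed
  have "valid 1 single"
    by (auto simp: valid_def single_def)
  then show ?thesis
    unfolding coupling_def using V lt pos tops_le[OF assms(1,2)] assms(1)
    by (auto simp: strict_mono_on_def le_Suc_eq single_def split: if_splits)
qed

lemma avg_survives:
  assumes "k < m"
  shows "avg N (\<lambda>xs. of_bool (survives 1 single (map (relative k s) xs))) = surv_prob N"
  unfolding surv_prob_def by (rule avg_map[OF bij_relative[OF assms]])

lemma run_survives:
  assumes "valid T V" "k < m" "exposed (tops V) k" "\<forall>c\<in>set xs. fst c < m"
  shows "tops V k \<in> fst ` set (run T V xs k) \<longleftrightarrow> survives 1 single (map (relative k (snd (hd (V k)))) xs)"
  by (rule coupling_survives[OF coupling_init[OF assms(1-3)] assms(2,4)])

lemma exposed_push:
  assumes "valid T V" "k < m"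
  shows "exposed (tops (V(k := (Suc T, s) # V k))) k"
  using assms tops_le[OF assms(1), of "L k"] tops_le[OF assms(1), of "R k"]
  by (auto simp: exposed_def tops_def)

text \<open>A pushed piece has the largest stamp, hence is exposed, and the coupling turns its
  survival into an event about the relative drops alone. These are again uniform, so V only decides
  whether the drop is a push.\<close>

lemma avg_push_survives:
  assumes "valid T V" "k < m"
  shows "avg N (\<lambda>xs. of_bool (Suc T \<in> fst ` set (run (Suc T) (step T V (k, s)) xs k)))
    = (if exposed (tops V) k \<and> snd (hd (V k)) \<noteq> s then 0 else surv_prob N)"
proof (cases "exposed (tops V) k \<and> snd (hd (V k)) \<noteq> s")
  case True
  then have "set (step T V (k, s) k) \<subseteq> set (V k)"
    by (cases "V k") (auto simp: step_pop)
  then have "Suc T \<notin> fst ` set (run (Suc T) (step T V (k, s)) xs k)" for xs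
    using validD(3)[OF assms] by (force dest: run_old_stamps)
  then show ?thesis
    using True by simp
next
  case False
  then have st: "step T V (k, s) = V(k := (Suc T, s) # V k)"
    by (intro step_push) blast
  have v: "valid (Suc T) (V(k := (Suc T, s) # V k))"
    using valid_step[OF assms(1), of "(k, s)"] st by simp
  have "avg N (\<lambda>xs. of_bool (Suc T \<in> fst ` set (run (Suc T) (step T V (k, s)) xs k)))
    = avg N (\<lambda>xs. of_bool (survives 1 single (map (relative k s) xs)))"
  proof (rule avg_cong)
    fix xs assume "set xs \<subseteq> choices"
    then have "\<forall>c\<in>set xs. fst c < m"
      by (auto simp: choices_def)
    from run_survives[OF v assms(2) exposed_push[OF assms] this]
    show "of_bool (Suc T \<in> fst ` set (run (Suc T) (step T V (k, s)) xs k))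
      = (of_bool (survives 1 single (map (relative k s) xs)) :: real)"
      by (simp add: st tops_def)
  qed
  also have "\<dots> = surv_prob N"
    by (rule avg_survives[OF assms(2)])
  finally show ?thesis
    using False by auto
qed

lemma survives_append: "survives T U (xs @ ys) \<Longrightarrow> survives T U xs"
proof (induction xs arbitrary: T U)
  case Nil
  then show ?case
    by (cases ys) auto
qed auto

section \<open>The limit of the survival probabilities\<close>

lemma surv_prob_nonneg: "0 \<le> surv_prob N"
  using avg_mono[of N "\<lambda>_. 0" "\<lambda>xs. of_bool (survives 1 single xs)"] by (simp add: surv_prob_def)

lemma surv_prob_Suc_le: "surv_prob (Suc N) \<le> surv_prob N"
proof -
  have "surv_prob (N + 1) \<le> avg N (\<lambda>xs. avg 1 (\<lambda>ys. of_bool (survives 1 single xs)))"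
    unfolding surv_prob_def avg_append
    by (intro avg_mono) (auto dest: survives_append)
  then show ?thesis
    by (simp add: surv_prob_def)
qed

lemma decseq_surv_prob: "decseq surv_prob"
  by (intro decseq_SucI surv_prob_Suc_le)

definition immortal_prob :: real where
  "immortal_prob = (INF N. surv_prob N)"

lemma surv_prob_tendsto: "surv_prob \<longlonglongrightarrow> immortal_prob"
  unfolding immortal_prob_def
  by (rule LIMSEQ_decseq_INF[OF _ decseq_surv_prob]) (auto intro: bdd_belowI2 surv_prob_nonneg)

lemma immortal_prob_le: "immortal_prob \<le> surv_prob N"
  using decseq_ge[OF decseq_surv_prob surv_prob_tendsto] .

section \<open>Counting pieces to bound the immortality probability from below\<close>

definition total :: "stacks \<Rightarrow> real" where
  "total V = (\<Sum>k<m. real (length (V k)))"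

definition old_total :: "nat \<Rightarrow> stacks \<Rightarrow> real" where
  "old_total T V = (\<Sum>k<m. real (length (filter (\<lambda>x. fst x \<le> T) (V k))))"

lemma total_update: "k < m \<Longrightarrow> total (V(k := xs)) = total V - length (V k) + length xs"
  unfolding total_def by (subst (1 2) sum.remove[of _ k]) (auto intro!: sum.cong)

text \<open>In an exposed column one sign adds a piece and the other removes one; elsewhere both
  signs add one. At most half of the columns are exposed.\<close>

lemma mean_total_step:
  assumes "valid T V"
  shows "total V + 1 / 2 \<le> mean (\<lambda>c. total (step T V c))"
proof -
  have "(\<Sum>c\<in>choices. total (step T V c)) = (\<Sum>k<m. \<Sum>s\<in>{Plus, Minus}. total (step T V (k, s)))"
    unfolding choices_def by (simp only: sum.cartesian_product split_def prod.collapse)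
  also have "\<dots> \<ge> (\<Sum>k<m. 2 * total V + 2 * (1 - of_bool (exposed (tops V) k)))"
  proof (rule sum_mono)
    fix k assume "k \<in> {..<m}"
    then have k: "k < m"
      by simp
    show "2 * total V + 2 * (1 - of_bool (exposed (tops V) k)) \<le> (\<Sum>s\<in>{Plus, Minus}. total (step T V (k, s)))"
    proof (cases "exposed (tops V) k")
      case True
      then have "V k \<noteq> []"
        by (rule exposed_nonempty)
      then have "total (V(k := tl (V k))) = total V - 1"
        using k by (cases "V k") (auto simp: total_update)
      then show ?thesis
        using True k by (cases "snd (hd (V k))") (auto simp: step_pop step_push total_update)
    next
      case False
      then show ?thesis
        using k by (auto simp: step_push total_update)
    qed
  qed
  also have "(\<Sum>k<m. 2 * total V + 2 * (1 - of_bool (exposed (tops V) k)))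
      = 2 * m * total V + 2 * (m - rc (tops V))"
    by (simp add: rc_def sum.distrib sum_subtractf flip: sum_distrib_left)
  finally have "2 * m * total V + 2 * (m - rc (tops V)) \<le> (\<Sum>c\<in>choices. total (step T V c))" .
  then have "2 * m * total V + m \<le> (\<Sum>c\<in>choices. total (step T V c))"
    using rc_le_half[of "tops V"] by simp
  then show ?thesis
    using m_pos by (simp add: mean_def field_simps)
qed

lemma avg_total_run: "valid T V \<Longrightarrow> total V + N / 2 \<le> avg N (\<lambda>xs. total (run T V xs))"
proof (induction N arbitrary: T V)
  case (Suc N)
  have "total V + 1 / 2 + N / 2 \<le> mean (\<lambda>c. total (step T V c)) + mean (\<lambda>_. N / 2)"
    using mean_total_step[OF Suc.prems] by simp
  also have "\<dots> = mean (\<lambda>c. total (step T V c) + N / 2)"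
    by (simp add: mean_add)
  also have "\<dots> \<le> avg (Suc N) (\<lambda>xs. total (run T V xs))"
    using Suc.IH[OF valid_step[OF Suc.prems]] by (auto intro!: mean_mono)
  finally show ?case
    by (simp add: field_simps)
qed simp

lemma old_total_Suc:
  assumes "valid T V" "k < m"
  defines "Vf s xs \<equiv> run (Suc T) (step T V (k, s)) xs"
  shows "old_total (Suc T) (Vf s xs) \<le> old_total T (Vf s xs) + of_bool (Suc T \<in> fst ` set (Vf s xs k))"
proof -
  have v: "valid (Suc T + length xs) (Vf s xs)"
    unfolding Vf_def by (intro valid_run valid_step assms(1))
  have "length (filter (\<lambda>x. fst x \<le> Suc T) (Vf s xs j))
      \<le> length (filter (\<lambda>x. fst x \<le> T) (Vf s xs j)) + of_bool (j = k \<and> Suc T \<in> fst ` set (Vf s xs j))"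
    if j: "j < m" for j
  proof -
    have split: "length (filter (\<lambda>x. fst x \<le> Suc T) ys)
      = length (filter (\<lambda>x. fst x \<le> T) ys) + length (filter (\<lambda>x. fst x = Suc T) ys)"
      for ys :: "(nat \<times> sign) list"
      by (induction ys) auto
    have one: "length (filter (\<lambda>x. fst x = Suc T) ys) \<le> of_bool (Suc T \<in> fst ` set ys)"
      if "sorted_wrt (>) (map fst ys)" for ys :: "(nat \<times> sign) list"
      using that by (induction ys) (auto simp: filter_empty_conv)
    have jk: "j = k" if "Suc T \<in> fst ` set (Vf s xs j)"
    proof (rule ccontr)
      assume "j \<noteq> k"
      have "Suc T \<in> fst ` set (step T V (k, s) j)"
        using that unfolding Vf_def by (auto dest: run_old_stamps)
      then show False
        using \<open>j \<noteq> k\<close> validD(3)[OF assms(1) j] step_other[of j "(k, s)" T V] by fastforce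
    qed
    have "length (filter (\<lambda>x. fst x = Suc T) (Vf s xs j))
        \<le> of_bool (j = k \<and> Suc T \<in> fst ` set (Vf s xs j))"
      using one[OF validD(1)[OF v j]] jk by (cases "Suc T \<in> fst ` set (Vf s xs j)") simp_all
    then show ?thesis
      unfolding split[of "Vf s xs j"] by simp
  qed
  then have "old_total (Suc T) (Vf s xs) \<le> (\<Sum>j<m. real (length (filter (\<lambda>x. fst x \<le> T) (Vf s xs j))
      + of_bool (j = k \<and> Suc T \<in> fst ` set (Vf s xs j))))"
    unfolding old_total_def by (intro sum_mono of_nat_mono) auto
  also have "\<dots> = old_total T (Vf s xs) + (\<Sum>j<m. if j = k then of_bool (Suc T \<in> fst ` set (Vf s xs k)) else 0)"
    unfolding old_total_def of_nat_add sum.distrib by (intro arg_cong2[where f = "(+)"] sum.cong) auto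
  finally show ?thesis
    using assms(2) by simp
qed

text \<open>Induction over the drops: the piece of the current drop has N further drops to outlive,
  and does so with probability at most \<open>surv_prob N\<close>.\<close>

lemma avg_old_total:
  "valid T V \<Longrightarrow> avg N (\<lambda>xs. old_total (T + N) (run T V xs))
    \<le> avg N (\<lambda>xs. old_total T (run T V xs)) + (\<Sum>K<N. surv_prob K)"
proof (induction N arbitrary: T V)
  case (Suc N)
  let ?f = "\<lambda>c xs. run (Suc T) (step T V c) xs"
  have "avg (Suc N) (\<lambda>xs. old_total (T + Suc N) (run T V xs))
      = mean (\<lambda>c. avg N (\<lambda>xs. old_total (Suc T + N) (?f c xs)))"
    by simp
  also have "\<dots> \<le> mean (\<lambda>c. avg N (\<lambda>xs. old_total (Suc T) (?f c xs)) + (\<Sum>K<N. surv_prob K))"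
    using Suc.IH[OF valid_step[OF Suc.prems]] by (intro mean_mono) auto
  also have "\<dots> \<le> mean (\<lambda>c. avg N (\<lambda>xs. old_total T (?f c xs)) + surv_prob N + (\<Sum>K<N. surv_prob K))"
  proof (intro mean_mono add_right_mono)
    fix c assume "c \<in> choices"
    then obtain k s where c: "c = (k, s)" and k: "k < m"
      by (cases c) (auto simp: mem_choices)
    have "avg N (\<lambda>xs. old_total (Suc T) (?f c xs))
      \<le> avg N (\<lambda>xs. old_total T (?f c xs) + of_bool (Suc T \<in> fst ` set (?f c xs k)))"
      unfolding c by (intro avg_mono old_total_Suc Suc.prems k)
    also have "\<dots> \<le> avg N (\<lambda>xs. old_total T (?f c xs)) + surv_prob N"
      unfolding avg_add c avg_push_survives[OF Suc.prems k] using surv_prob_nonneg by simp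
    finally show "avg N (\<lambda>xs. old_total (Suc T) (?f c xs)) \<le> avg N (\<lambda>xs. old_total T (?f c xs)) + surv_prob N" .
  qed
  finally show ?case
    by (simp add: mean_add)
qed simp

text \<open>From the empty heap, the expected number of pieces after N drops is at least N / 2 by
  \<open>avg_total_run\<close>, and at most the sum of the survival probabilities by
  linearity.\<close>

lemma sum_surv_prob: "real N / 2 \<le> (\<Sum>K<N. surv_prob K)"
proof -
  let ?V = "\<lambda>_. [] :: (nat \<times> sign) list"
  have v: "valid 0 ?V"
    by (simp add: valid_def)
  have "real N / 2 \<le> avg N (\<lambda>xs. total (run 0 ?V xs))"
    using avg_total_run[OF v, of N] by (simp add: total_def)
  also have "\<dots> = avg N (\<lambda>xs. old_total (0 + N) (run 0 ?V xs))"
  proof (rule avg_cong)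
    fix xs :: "(nat \<times> sign) list" assume "length xs = N"
    then have "filter (\<lambda>x. fst x \<le> N) (run 0 ?V xs k) = run 0 ?V xs k" if "k < m" for k
      using validD(3)[OF valid_run[OF v, of xs] that] by (auto simp: filter_id_conv)
    then show "total (run 0 ?V xs) = old_total (0 + N) (run 0 ?V xs)"
      by (simp add: total_def old_total_def)
  qed
  also have "\<dots> \<le> avg N (\<lambda>xs. old_total 0 (run 0 ?V xs)) + (\<Sum>K<N. surv_prob K)"
    by (rule avg_old_total[OF v])
  also have "avg N (\<lambda>xs. old_total 0 (run 0 ?V xs)) = 0"
  proof -
    have "filter (\<lambda>x. fst x \<le> 0) (run 0 ?V xs k) = []" for xs k
      unfolding filter_empty_conv using run_old_stamps[of _ 0 ?V xs k] by fastforce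
    then have "old_total 0 (run 0 ?V xs) = 0" for xs
      by (simp only: old_total_def) simp
    then show ?thesis
      by simp
  qed
  finally show ?thesis
    by simp
qed

text \<open>The Cesaro means of \<open>surv_prob\<close> are at least 1 / 2, and they share its
  limit.\<close>

lemma immortal_prob_ge: "1 / 2 \<le> immortal_prob"
proof (rule ccontr)
  assume "\<not> ?thesis"
  then have "immortal_prob < 1 / 2"
    by simp
  then obtain K where K: "surv_prob K < 1 / 2"
    using order_tendstoD(2)[OF surv_prob_tendsto] by (meson eventually_sequentially order_refl)
  define e where "e = 1 / 2 - surv_prob K"
  have e: "0 < e"
    using K by (simp add: e_def)
  have bound: "(\<Sum>i<K + n. surv_prob i) \<le> (\<Sum>i<K. surv_prob i) + n * (1 / 2 - e)" for n
  proof (induction n)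
    case (Suc n)
    have "surv_prob (K + n) \<le> 1 / 2 - e"
      using decseqD[OF decseq_surv_prob, of K "K + n"] by (simp add: e_def)
    then show ?case
      using Suc by (simp add: field_simps)
  qed simp
  obtain n where n: "(\<Sum>i<K. surv_prob i) / e < real n"
    using reals_Archimedean2 by blast
  then have "(\<Sum>i<K. surv_prob i) < n * e"
    using e by (simp add: field_simps)
  moreover have "real (K + n) / 2 \<le> (\<Sum>i<K. surv_prob i) + n * (1 / 2 - e)"
    using sum_surv_prob[of "K + n"] bound[of n] by linarith
  ultimately show False
    by (simp add: field_simps)
qed

subsection \<open>A uniform bound for the mean roof\<close>

text \<open>The two orientations of the cycle, so that covers from the left and from the right are
  handled by one argument.\<close>

definition mirror :: "(nat \<Rightarrow> nat) \<Rightarrow> (nat \<Rightarrow> nat) \<Rightarrow> bool" where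
  "mirror F G \<longleftrightarrow> (F = L \<and> G = R) \<or> (F = R \<and> G = L)"

lemma mirrorD:
  assumes "mirror F G"
  shows "F k < m" "G k < m" "exposed g k \<longleftrightarrow> g (F k) < g k \<and> g (G k) < g k" "{L k, k, R k} = {F k, k, G k}"
  using assms by (auto simp: mirror_def exposed_def)

lemma mirror_arith:
  assumes "mirror F G" "k < m"
  shows "F (G k) = k" "G (F k) = k" "F k \<noteq> k" "G k \<noteq> k" "F k \<noteq> G k" "F (F k) \<noteq> k" "G (G k) \<noteq> k"
    "F (F k) \<noteq> G k" "G (G k) \<noteq> F k"
  using assms by (auto simp: mirror_def)

text \<open>Removing the top piece of column \<open>F i\<close> would put the top piece of column \<open>i\<close> into the roof.\<close>

definition half_covered :: "(nat \<Rightarrow> nat) \<Rightarrow> (nat \<Rightarrow> nat) \<Rightarrow> stacks \<Rightarrow> nat \<Rightarrow> bool" where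
  "half_covered F G V i \<longleftrightarrow> exposed (tops V) (F i) \<and> top_stamp (tl (V (F i))) < tops V i
     \<and> tops V (G i) < tops V i"

definition half_covered_count :: "stacks \<Rightarrow> real" where
  "half_covered_count V = (\<Sum>i<m. of_bool (half_covered L R V i) + of_bool (half_covered R L V i))"

lemma half_covered_count_le: "half_covered_count V \<le> 2 * m"
proof -
  have "half_covered_count V \<le> (\<Sum>i<m. 2)"
    unfolding half_covered_count_def by (rule sum_mono) simp
  then show ?thesis
    by simp
qed

lemma half_covered_not_exposed: "mirror F G \<Longrightarrow> i < m \<Longrightarrow> half_covered F G V i \<Longrightarrow> \<not> exposed (tops V) i"
  by (auto simp: half_covered_def mirrorD(3)[of F G] mirror_arith)

lemma half_covered_cong:
  assumes "mirror F G" "i < m" "\<And>j. j \<in> {F (F i), F i, i, G i} \<Longrightarrow> V j = V' j"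
  shows "half_covered F G V i \<longleftrightarrow> half_covered F G V' i"
  using assms(3) by (simp add: half_covered_def tops_def mirrorD(3)[OF assms(1)] mirror_arith[OF assms(1,2)])

lemma mean_of_bool_fst:
  assumes "C \<subseteq> {..<m}"
  shows "mean (\<lambda>c. of_bool (fst c \<in> C)) = card C / m" "mean (\<lambda>c. of_bool (fst c \<notin> C)) = 1 - card C / m"
proof -
  have *: "(\<Sum>k<m. of_bool (k \<in> C)) = real (card C)"
    using assms by (subst sum_of_bool_eq) (auto simp: Int_absorb1 Int_absorb2)
  then show 1: "mean (\<lambda>c. of_bool (fst c \<in> C)) = card C / m"
    by (subst mean_fst) simp
  have "mean (\<lambda>c. of_bool (fst c \<notin> C)) = mean (\<lambda>c. 1 - of_bool (fst c \<in> C))"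
    by (intro mean_cong) simp
  then show "mean (\<lambda>c. of_bool (fst c \<notin> C)) = 1 - card C / m"
    using 1 by (simp add: mean_diff)
qed

text \<open>The status of i depends on four columns, \<open>F (F i)\<close> entering through the
  exposure of \<open>F i\<close>, so a drop elsewhere keeps it. If i is exposed then
  \<open>F i\<close> is not, so a drop there is a push and creates a half cover.\<close>

lemma half_covered_step:
  assumes "mirror F G" "valid T V" "i < m"
  shows "of_bool (half_covered F G V i) * of_bool (fst c \<notin> {F (F i), F i, i, G i})
      + of_bool (exposed (tops V) i) * of_bool (fst c \<in> {F i})
    \<le> (of_bool (half_covered F G (step T V c) i) :: real)"
proof (cases "exposed (tops V) i")
  case True
  note a = mirror_arith[OF assms(1,3)]
  have "half_covered F G (step T V c) i" if c: "fst c = F i"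
  proof -
    have "\<not> exposed (tops V) (F i)"
      using True mirrorD(3)[OF assms(1)] a by auto
    then have st: "step T V c = V(F i := (Suc T, snd c) # V (F i))"
      using step_push[of V "F i" "snd c" T] c by (metis prod.collapse)
    show ?thesis
      using exposed_push[OF assms(2) mirrorD(1)[OF assms(1)], of i "snd c"] True a(3-5) a(3-5)[symmetric]
      unfolding half_covered_def st mirrorD(3)[OF assms(1), of _ i] by (simp add: tops_def)
  qed
  then show ?thesis
    using half_covered_not_exposed[OF assms(1,3)] True by auto
next
  case False
  have "half_covered F G (step T V c) i = half_covered F G V i" if "fst c \<notin> {F (F i), F i, i, G i}"
    using that by (intro half_covered_cong[OF assms(1,3)] step_other) auto
  then show ?thesis
    using False by auto
qed

lemma mean_half_covered:
  assumes "mirror F G" "valid T V" "i < m"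
  shows "(1 - 4 / m) * of_bool (half_covered F G V i) + of_bool (exposed (tops V) i) / m
    \<le> mean (\<lambda>c. of_bool (half_covered F G (step T V c) i))"
proof -
  let ?D = "{F (F i), F i, i, G i}"
  have D: "?D \<subseteq> {..<m}" "{F i} \<subseteq> {..<m}"
    using mirrorD[OF assms(1)] assms(3) by auto
  have "card ?D \<le> 4"
    using card_insert_le_m1[of 4 "{F i, i, G i}" "F (F i)"] card_insert_le_m1[of 3 "{i, G i}" "F i"]
      card_insert_le_m1[of 2 "{G i}" i] by simp
  then have "1 - 4 / m \<le> mean (\<lambda>c. of_bool (fst c \<notin> ?D))"
    unfolding mean_of_bool_fst(2)[OF D(1)] using m_pos by (simp add: divide_right_mono)
  then have "(1 - 4 / m) * of_bool (half_covered F G V i) + of_bool (exposed (tops V) i) / m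
    \<le> of_bool (half_covered F G V i) * mean (\<lambda>c. of_bool (fst c \<notin> ?D))
      + of_bool (exposed (tops V) i) * mean (\<lambda>c. of_bool (fst c \<in> {F i}))"
    unfolding mean_of_bool_fst(1)[OF D(2)] by simp
  also have "\<dots> = mean (\<lambda>c. of_bool (half_covered F G V i) * of_bool (fst c \<notin> ?D)
      + of_bool (exposed (tops V) i) * of_bool (fst c \<in> {F i}))"
    unfolding mean_add mean_cmult ..
  also have "\<dots> \<le> mean (\<lambda>c. of_bool (half_covered F G (step T V c) i))"
    by (intro mean_mono half_covered_step assms)
  finally show ?thesis .
qed

lemma mean_sum: "mean (\<lambda>c. \<Sum>i\<in>I. f i c) = (\<Sum>i\<in>I. mean (f i))"
  unfolding mean_def by (simp add: sum_divide_distrib sum.swap[of _ choices])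

text \<open>Each half cover is lost with probability at most 4 / m, and each side of a roof piece
  yields a new one with probability 1 / m. In equilibrium this forces at least half as many half
  covers as roof pieces.\<close>

lemma mean_half_covered_count:
  assumes "valid T V"
  shows "(1 - 4 / m) * half_covered_count V + 2 * rc (tops V) / m
    \<le> mean (\<lambda>c. half_covered_count (step T V c))"
proof -
  have "(1 - 4 / m) * half_covered_count V + 2 * rc (tops V) / m
    = (\<Sum>i<m. ((1 - 4 / m) * of_bool (half_covered L R V i) + of_bool (exposed (tops V) i) / m)
      + ((1 - 4 / m) * of_bool (half_covered R L V i) + of_bool (exposed (tops V) i) / m))"
    unfolding half_covered_count_def rc_def sum_distrib_left sum_divide_distrib sum.distrib[symmetric]
    by (intro sum.cong) (auto simp: algebra_simps)
  also have "\<dots> \<le> (\<Sum>i<m. mean (\<lambda>c. of_bool (half_covered L R (step T V c) i))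
      + mean (\<lambda>c. of_bool (half_covered R L (step T V c) i)))"
    using assms by (intro sum_mono add_mono mean_half_covered) (auto simp: mirror_def)
  also have "\<dots> = mean (\<lambda>c. half_covered_count (step T V c))"
    unfolding half_covered_count_def mean_sum mean_add ..
  finally show ?thesis .
qed

section \<open>Extra covers through the first drop near a half-covered piece\<close>

primrec first_hit :: "nat set \<Rightarrow> nat \<times> sign \<Rightarrow> ((nat \<times> sign) list \<Rightarrow> bool) \<Rightarrow> (nat \<times> sign) list \<Rightarrow> bool" where
  "first_hit C a P [] \<longleftrightarrow> False"
| "first_hit C a P (c # xs) \<longleftrightarrow> (if fst c \<in> C then c = a \<and> P xs else first_hit C a P xs)"

text \<open>A lower bound for the probability that a drop avoids at most five given columns. The
  maximum matters for m = 4, where 1 - 5 / m is negative.\<close>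

definition miss_bound :: real where
  "miss_bound = max 0 (1 - 5 / m)"

lemma miss_bound: "0 \<le> miss_bound" "miss_bound < 1"
  using m_pos by (auto simp: miss_bound_def)

text \<open>At most five columns carry at most ten choices, one of which is \<open>a\<close>; hence
  the factor 1 / 10. The power of \<open>miss_bound\<close> accounts for the absence of a hit within
  N drops, and the bound on P holds however many drops remain.\<close>

lemma avg_first_hit:
  assumes C: "C \<subseteq> {..<m}" "card C \<le> 5" and a: "a \<in> choices" "fst a \<in> C"
    and P: "\<And>N. immortal_prob \<le> avg N (\<lambda>xs. of_bool (P xs))"
  shows "immortal_prob / 10 * (1 - miss_bound ^ N) \<le> avg N (\<lambda>xs. of_bool (first_hit C a P xs))"
proof (induction N)
  case (Suc N)
  let ?E = "avg N (\<lambda>xs. of_bool (first_hit C a P xs))" and ?p = "avg N (\<lambda>xs. of_bool (P xs)) :: real"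
  have E: "0 \<le> ?E"
    using avg_mono[of N "\<lambda>_. 0" "\<lambda>xs. of_bool (first_hit C a P xs)"] by simp
  have "avg (Suc N) (\<lambda>xs. of_bool (first_hit C a P xs)) = mean (\<lambda>c. ?p * of_bool (c = a) + ?E * of_bool (fst c \<notin> C))"
    using a by (auto intro!: mean_cong)
  also have "\<dots> = ?p * (1 / (2 * m)) + ?E * (1 - card C / m)"
  proof -
    have "mean (\<lambda>c. of_bool (c = a)) = 1 / (2 * real m)"
      using a by (simp add: mean_def of_bool_def sum.delta)
    then show ?thesis
      unfolding mean_add mean_cmult mean_of_bool_fst(2)[OF C(1)] by simp
  qed
  also have "\<dots> \<ge> immortal_prob * (1 / (2 * m)) + (immortal_prob / 10 * (1 - miss_bound ^ N)) * miss_bound"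
  proof (intro add_mono mult_right_mono mult_mono P Suc.IH)
    have "card C \<le> m"
      using C(1) by (metis card_lessThan card_mono finite_lessThan)
    then show "miss_bound \<le> 1 - card C / m"
      using C(2) m_pos by (auto simp: miss_bound_def divide_right_mono)
  qed (use E miss_bound in auto)
  finally have *: "immortal_prob * (1 / (2 * m)) + (immortal_prob / 10 * (1 - miss_bound ^ N)) * miss_bound
    \<le> avg (Suc N) (\<lambda>xs. of_bool (first_hit C a P xs))" .
  \<comment> \<open>Here 1 is at most 5 / m + \<open>miss_bound\<close>, and a tenth of 5 / m is the
    chance 1 / (2 m) of the choice \<open>a\<close>.\<close>
  have "immortal_prob / 10 * (1 - miss_bound ^ Suc N) \<le> immortal_prob / 10 * (5 / m + miss_bound - miss_bound ^ Suc N)"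
    using immortal_prob_ge by (intro mult_left_mono) (auto simp: miss_bound_def)
  also have "\<dots> = immortal_prob * (1 / (2 * m)) + (immortal_prob / 10 * (1 - miss_bound ^ N)) * miss_bound"
    using m_pos by (simp add: field_simps)
  finally show ?case
    using * by linarith
qed simp

text \<open>The five columns decide the exposure of \<open>F i\<close> and \<open>G i\<close>, so
  both stay exposed until the first hit. The hit annihilates the top of \<open>F i\<close> and
  leaves \<open>G i\<close> exposed, and \<open>run_survives\<close> takes over for its top
  piece.\<close>

lemma run_first_hit:
  assumes "mirror F G" "i < m"
    and "valid T V" "exposed (tops V) (F i)" "snd (hd (V (F i))) \<noteq> z" "exposed (tops V) (G i)"
    and "first_hit {F (F i), F i, i, G i, G (G i)} (F i, z)
      (\<lambda>xs. survives 1 single (map (relative (G i) (snd (hd (V (G i))))) xs)) xs"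
    and "\<forall>c\<in>set xs. fst c < m"
  shows "tops V (G i) \<in> fst ` set (run T V xs (G i))" "tops V (F i) \<notin> fst ` set (run T V xs (F i))"
proof -
  note mi = mirrorD[OF assms(1)] and a = mirror_arith[OF assms(1,2)]
  let ?C = "{F (F i), F i, i, G i, G (G i)}"
  have "tops V (G i) \<in> fst ` set (run T V xs (G i)) \<and> tops V (F i) \<notin> fst ` set (run T V xs (F i))"
    using assms(3-)
  proof (induction xs arbitrary: T V)
    case (Cons c xs)
    let ?V = "step T V c"
    have v: "valid (Suc T) ?V"
      by (rule valid_step[OF Cons.prems(1)])
    have xs: "\<forall>c\<in>set xs. fst c < m"
      using Cons.prems(6) by simp
    show ?case
    proof (cases "fst c \<in> ?C")
      case True
      then have c: "c = (F i, z)"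
        and surv: "survives 1 single (map (relative (G i) (snd (hd (V (G i))))) xs)"
        using Cons.prems(5) by auto
      have st: "?V = V(F i := tl (V (F i)))"
        unfolding c using Cons.prems(2,3) by (rule step_pop)
      have VG: "?V (G i) = V (G i)" "tops ?V (G i) = tops V (G i)"
        using a by (auto simp: st tops_def)
      have "exposed (tops ?V) (G i)"
        using Cons.prems(4) a mi(2) by (auto simp: mi(3) st tops_def)
      from run_survives[OF v mi(2) this xs]
      have 1: "tops V (G i) \<in> fst ` set (run T V (c # xs) (G i))"
        using surv VG by simp
      have "V (F i) \<noteq> []"
        using exposed_nonempty[OF Cons.prems(2)] .
      then have "tops V (F i) \<notin> fst ` set (?V (F i))"
        using validD(1)[OF Cons.prems(1) mi(1), of i] by (cases "V (F i)") (auto simp: st tops_def)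
      moreover have "tops V (F i) \<le> Suc T"
        using tops_le[OF Cons.prems(1) mi(1)] by (simp add: le_SucI)
      ultimately have "tops V (F i) \<notin> fst ` set (run T V (c # xs) (F i))"
        by (auto dest!: run_old_stamps)
      then show ?thesis
        using 1 by blast
    next
      case False
      then have eq: "?V j = V j" if "j \<in> ?C" for j
        using that by (intro step_other) auto
      have teq: "tops ?V j = tops V j" if "j \<in> ?C" for j
        using eq[OF that] by (simp add: tops_def)
      have "exposed (tops ?V) (F i)" "exposed (tops ?V) (G i)"
        using Cons.prems(2,4) by (simp_all add: mi(3) a teq)
      from Cons.IH[OF v this(1) _ this(2) _ xs] show ?thesis
        using Cons.prems(3,5) False by (simp add: eq teq)
    qed
  qed simp
  then show "tops V (G i) \<in> fst ` set (run T V xs (G i))" "tops V (F i) \<notin> fst ` set (run T V xs (F i))"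
    by blast+
qed

text \<open>The drop on \<open>G i\<close> covers i from the second side. If the first cover is then
  removed and the second one lasts, the top of i survives beneath it and is in the roof of the
  survivors from time \<open>T\<close>, although it was covered in V.\<close>

lemma half_covered_extra:
  fixes s :: sign and xs :: "(nat \<times> sign) list"
  assumes "mirror F G" "i < m" "valid T V" "half_covered F G V i" "snd (hd (V (F i))) \<noteq> z"
  defines "Vf \<equiv> run (Suc T) (step T V (G i, s)) xs"
  assumes "first_hit {F (F i), F i, i, G i, G (G i)} (F i, z)
      (\<lambda>xs. survives 1 single (map (relative (G i) s) xs)) xs"
    and "\<forall>c\<in>set xs. fst c < m"
  shows "Suc T \<in> fst ` set (Vf (G i))" "exposed (old_top T Vf) i"
proof -
  note mi = mirrorD[OF assms(1)] and a = mirror_arith[OF assms(1,2)]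
  have hc: "exposed (tops V) (F i)" "top_stamp (tl (V (F i))) < tops V i" "tops V (G i) < tops V i"
    using assms(4) by (auto simp: half_covered_def)
  have ne: "\<not> exposed (tops V) (G i)"
    using hc(3) a by (auto simp: mi(3))
  have st: "step T V (G i, s) = V(G i := (Suc T, s) # V (G i))"
    using ne by (intro step_push) simp
  let ?V = "step T V (G i, s)"
  have v: "valid (Suc T) ?V"
    by (rule valid_step[OF assms(3)])
  have F: "?V (F i) = V (F i)" "tops ?V (F i) = tops V (F i)"
    using a by (auto simp: st tops_def)
  have exF: "exposed (tops ?V) (F i)"
    using hc(1) a by (auto simp: mi(3) st tops_def)
  have exG: "exposed (tops ?V) (G i)"
    unfolding st by (rule exposed_push[OF assms(3) mi(2)])
  have G: "snd (hd (?V (G i))) = s" "tops ?V (G i) = Suc T"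
    by (auto simp: st tops_def)
  note hit = run_first_hit[OF assms(1,2) v exF _ exG, of z xs, unfolded F G, OF assms(5,7,8)]
  show T: "Suc T \<in> fst ` set (Vf (G i))"
    using hit(1) by (simp add: Vf_def)
  have "G i \<in> {L i, i, R i}"
    using mi(4) by auto
  then have "i \<in> {L (G i), G i, R (G i)}"
    using assms(2) by auto
  moreover have "V i \<noteq> []"
    using hc(2) by (auto simp: tops_def)
  ultimately have "tops V i \<le> old_top T Vf i"
    using tops_le_old_top[OF assms(3) mi(2)[of i], of i s xs] ne T by (auto simp: Vf_def)
  \<comment> \<open>The cutoff \<open>T\<close> leaves out the new cover, whose stamp is
    \<open>Suc T\<close>.\<close>
  moreover have "old_top T Vf (G i) \<le> tops V (G i)"
    using old_top_run_le[OF assms(3) mi(2), of "(G i, s) # xs"] by (simp add: Vf_def)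
  moreover have "old_top T Vf (F i) \<le> top_stamp (tl (V (F i)))"
  proof (rule old_top_leI)
    fix x assume x: "x \<in> set (Vf (F i))" "fst x \<le> T"
    have "x \<in> set (V (F i))"
      using x run_old_stamps[of x T V "(G i, s) # xs" "F i"] by (simp add: Vf_def)
    moreover have "fst x \<noteq> tops V (F i)"
      using hit(2) x(1) unfolding Vf_def by (metis imageI)
    ultimately have "x \<in> set (tl (V (F i)))"
      by (cases "V (F i)") (auto simp: tops_def)
    then show "fst x \<le> top_stamp (tl (V (F i)))"
      using validD(1)[OF assms(3) mi(1), of i] by (cases "V (F i)"; cases "tl (V (F i))") auto
  qed
  ultimately show "exposed (old_top T Vf) i"
    using hc unfolding mi(3) by linarith
qed

lemma avg_extra:
  assumes "mirror F G" "k < m" "valid T V"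
  defines "Vf s xs \<equiv> run (Suc T) (step T V (k, s)) xs"
  shows "immortal_prob / 10 * (1 - miss_bound ^ N) * of_bool (half_covered F G V (F k))
    \<le> avg N (\<lambda>xs. of_bool (Suc T \<in> fst ` set (Vf s xs k)) *
      of_bool (\<not> exposed (tops V) (F k) \<and> exposed (old_top T (Vf s xs)) (F k)))"
proof (cases "half_covered F G V (F k)")
  case True
  \<comment> \<open>Seen from the half-covered column i, the drop on k comes from the opposite side
    \<open>G i\<close>.\<close>
  define i where "i = F k"
  have i: "i < m" and k: "k = G i"
    using mirrorD(1)[OF assms(1)] mirror_arith[OF assms(1,2)] by (auto simp: i_def)
  have hc: "half_covered F G V i"
    using True by (simp add: i_def)
  obtain z where z: "snd (hd (V (F i))) \<noteq> z"
    by (metis sign.distinct(1))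
  let ?C = "{F (F i), F i, i, G i, G (G i)}" and ?P = "\<lambda>xs. survives 1 single (map (relative k s) xs)"
  have "immortal_prob / 10 * (1 - miss_bound ^ N) \<le> avg N (\<lambda>xs. of_bool (first_hit ?C (F i, z) ?P xs))"
  proof (rule avg_first_hit)
    show "card ?C \<le> 5"
      using card_insert_le_m1[of 5 "{F i, i, G i, G (G i)}" "F (F i)"] card_insert_le_m1[of 4 "{i, G i, G (G i)}" "F i"]
        card_insert_le_m1[of 3 "{G i, G (G i)}" i] card_insert_le_m1[of 2 "{G (G i)}" "G i"] by simp
    show "immortal_prob \<le> avg N (\<lambda>xs. of_bool (?P xs))" for N
      unfolding avg_survives[OF assms(2)] by (rule immortal_prob_le)
  qed (use mirrorD(1,2)[OF assms(1)] i in \<open>auto simp: mem_choices\<close>)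
  also have "\<dots> \<le> avg N (\<lambda>xs. of_bool (Suc T \<in> fst ` set (Vf s xs k)) *
      of_bool (\<not> exposed (tops V) (F k) \<and> exposed (old_top T (Vf s xs)) (F k)))"
  proof (rule avg_mono)
    fix xs assume "set xs \<subseteq> choices"
    then have xs: "\<forall>c\<in>set xs. fst c < m"
      by (auto simp: choices_def)
    show "of_bool (first_hit ?C (F i, z) ?P xs) \<le> (of_bool (Suc T \<in> fst ` set (Vf s xs k)) *
      of_bool (\<not> exposed (tops V) (F k) \<and> exposed (old_top T (Vf s xs)) (F k)) :: real)"
    proof (cases "first_hit ?C (F i, z) ?P xs")
      case True
      note half_covered_extra[OF assms(1) i assms(3) hc z True[unfolded k] xs]
      then show ?thesis
        using half_covered_not_exposed[OF assms(1) i hc] unfolding Vf_def k by (simp add: mirror_arith(1)[OF assms(1) i])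
    qed simp
  qed
  finally show ?thesis
    using True by simp
next
  case False
  then show ?thesis
    using avg_mono[of N "\<lambda>_. 0"] by simp
qed

section \<open>Drift of the surviving roof and the bound on the mean roof\<close>

definition final_rc :: "nat \<Rightarrow> nat \<Rightarrow> stacks \<Rightarrow> real" where
  "final_rc N T V = avg N (\<lambda>xs. rc (old_top T (run T V xs)))"

lemma final_rc_bounds: "0 \<le> final_rc N T V" "final_rc N T V \<le> m"
  using avg_mono[of N "\<lambda>_. 0" "\<lambda>xs. rc (old_top T (run T V xs))"]
    avg_mono[of N "\<lambda>xs. rc (old_top T (run T V xs))" "\<lambda>_. m"]
  by (auto simp: final_rc_def rc_nonneg rc_le)

text \<open>Both expectations refer to the same final time. Averaging \<open>rc_old_top_step\<close>
  over the columns turns \<open>near\<close> into three times the roof density, and each half cover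
  contributes extra covers through \<open>avg_extra\<close>.\<close>

lemma mean_final_rc:
  assumes "valid T V"
  shows "mean (\<lambda>c. final_rc N (Suc T) (step T V c)) - final_rc (Suc N) T V
    \<le> surv_prob N * (1 - 3 * (rc (tops V) / m))
      - immortal_prob / 10 * (1 - miss_bound ^ N) * (half_covered_count V / m)"
proof -
  let ?q = "immortal_prob / 10 * (1 - miss_bound ^ N)"
  let ?Vf = "\<lambda>k s xs. run (Suc T) (step T V (k, s)) xs"
  let ?S = "\<lambda>k s xs. of_bool (Suc T \<in> fst ` set (?Vf k s xs k)) :: real"
  let ?X = "\<lambda>k s xs i. of_bool (\<not> exposed (tops V) i \<and> exposed (old_top T (?Vf k s xs)) i) :: real"
  let ?b = "\<lambda>k. surv_prob N * (1 - near (tops V) k)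
    - ?q * (of_bool (half_covered L R V (L k)) + of_bool (half_covered R L V (R k)))"
  have "mean (\<lambda>c. final_rc N (Suc T) (step T V c)) - final_rc (Suc N) T V
    = mean (\<lambda>c. avg N (\<lambda>xs. rc (old_top (Suc T) (run (Suc T) (step T V c) xs))
      - rc (old_top T (run (Suc T) (step T V c) xs))))"
    by (simp add: final_rc_def avg_diff mean_diff)
  also have "\<dots> \<le> mean (\<lambda>c. ?b (fst c))"
  proof (rule mean_mono)
    fix c assume "c \<in> choices"
    then obtain k s where c: "c = (k, s)" and k: "k < m"
      by (cases c) (auto simp: mem_choices)
    have "avg N (\<lambda>xs. rc (old_top (Suc T) (?Vf k s xs)) - rc (old_top T (?Vf k s xs)))
      \<le> avg N (\<lambda>xs. (1 - near (tops V) k) * ?S k s xs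
        - (?S k s xs * ?X k s xs (L k) + ?S k s xs * ?X k s xs (R k)))"
      by (intro avg_mono order.trans[OF rc_old_top_step[OF assms k]])
        (simp only: right_diff_distrib left_diff_distrib distrib_left distrib_right mult.commute mult_1 order_refl)
    also have "\<dots> = (1 - near (tops V) k) * avg N (?S k s)
      - (avg N (\<lambda>xs. ?S k s xs * ?X k s xs (L k)) + avg N (\<lambda>xs. ?S k s xs * ?X k s xs (R k)))"
      unfolding avg_diff avg_add avg_cmult ..
    also have "\<dots> \<le> ?b k"
    proof -
      \<comment> \<open>On an exposed column survival depends on the sign, but there
        \<open>near\<close> equals 1 and both sides vanish.\<close>
      have "(1 - near (tops V) k) * avg N (?S k s) = surv_prob N * (1 - near (tops V) k)"
        using avg_push_survives[OF assms k, of N s] near_exposed[OF k] by auto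
      moreover have "?q * of_bool (half_covered L R V (L k)) \<le> avg N (\<lambda>xs. ?S k s xs * ?X k s xs (L k))"
        "?q * of_bool (half_covered R L V (R k)) \<le> avg N (\<lambda>xs. ?S k s xs * ?X k s xs (R k))"
        using avg_extra[OF _ k assms] by (auto simp: mirror_def)
      ultimately show ?thesis
        by (simp only: distrib_left)
    qed
    finally show "avg N (\<lambda>xs. rc (old_top (Suc T) (run (Suc T) (step T V c) xs))
      - rc (old_top T (run (Suc T) (step T V c) xs))) \<le> ?b (fst c)"
      by (simp add: c)
  qed
  also have "\<dots> = (\<Sum>k<m. ?b k) / m"
    by (rule mean_fst)
  also have "(\<Sum>k<m. ?b k) = surv_prob N * (m - 3 * rc (tops V)) - ?q * half_covered_count V"
  proof -
    have "(\<Sum>k<m. ?b k) = surv_prob N * (\<Sum>k<m. 1 - near (tops V) k)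
      - ?q * ((\<Sum>k<m. of_bool (half_covered L R V (L k))) + (\<Sum>k<m. of_bool (half_covered R L V (R k))))"
      unfolding sum_subtractf sum_distrib_left[symmetric] sum.distrib ..
    then show ?thesis
      unfolding sum_L[of "\<lambda>k. of_bool (half_covered L R V k) :: real"]
        sum_R[of "\<lambda>k. of_bool (half_covered R L V k) :: real"] half_covered_count_def
      by (simp add: sum_subtractf sum_near sum.distrib)
  qed
  finally show ?thesis
    using m_pos by (simp add: diff_divide_distrib right_diff_distrib)
qed

primrec roof_sum :: "nat \<Rightarrow> stacks \<Rightarrow> (nat \<times> sign) list \<Rightarrow> real" where
  "roof_sum T V [] = 0"
| "roof_sum T V (c # xs) = rc (tops V) + roof_sum (Suc T) (step T V c) xs"

lemma avg_roof_sum_Suc: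
  "avg (Suc N) (roof_sum T V) = rc (tops V) + mean (\<lambda>c. avg N (roof_sum (Suc T) (step T V c)))"
  by (simp add: avg_add mean_add)

text \<open>The error of a finite horizon: survival for N drops instead of immortality, and a
  missing first hit, weighted with \<open>half_covered_count V / m \<le> 2\<close>.\<close>

definition surplus :: "nat \<Rightarrow> real" where
  "surplus N = immortal_prob / 5 * miss_bound ^ N + surv_prob N - immortal_prob"

text \<open>Induction with \<open>final_rc\<close> and \<open>half_covered_count\<close> as
  potentials. The weight 1 / 40 is the rate 1 / 10 of extra covers divided by the loss factor 4; the
  gain 2 \<rho> of half covers then contributes 2 / 40, which raises 3 to 3.05.\<close>

lemma avg_roof_sum_bound:
  "valid T V \<Longrightarrow> 3.05 * immortal_prob * (avg N (roof_sum T V) / m) \<le> immortal_prob * N + final_rc N T V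
    - immortal_prob / 40 * half_covered_count V + immortal_prob * m / 20 + (\<Sum>K<N. surplus K)"
proof (induction N arbitrary: T V)
  case 0
  have "immortal_prob / 40 * half_covered_count V \<le> immortal_prob / 40 * (2 * m)"
    using half_covered_count_le immortal_prob_ge by (intro mult_left_mono) auto
  also have "\<dots> = immortal_prob * m / 20"
    by simp
  finally show ?case
    using final_rc_bounds(1)[of 0 T V] by simp
next
  case (Suc N)
  define h where "h = half_covered_count V"
  define h' where "h' = mean (\<lambda>c. half_covered_count (step T V c))"
  define \<rho> where "\<rho> = rc (tops V) / m"
  define b where "b = mean (\<lambda>c. final_rc N (Suc T) (step T V c))"
  define R' where "R' = mean (\<lambda>c. avg N (roof_sum (Suc T) (step T V c)) / m)"
  define \<sigma> where "\<sigma> = immortal_prob"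
  define s where "s = surv_prob N"
  define \<beta> where "\<beta> = miss_bound ^ N"
  have \<sigma>: "1 / 2 \<le> \<sigma>" "\<sigma> \<le> s" and \<rho>: "0 \<le> \<rho>" and \<beta>: "0 \<le> \<beta>"
    using immortal_prob_ge immortal_prob_le[of N] rc_nonneg miss_bound
    by (auto simp: \<sigma>_def s_def \<rho>_def \<beta>_def)
  have "mean (\<lambda>c. 3.05 * \<sigma> * (avg N (roof_sum (Suc T) (step T V c)) / m))
    \<le> mean (\<lambda>c. (final_rc N (Suc T) (step T V c) - \<sigma> / 40 * half_covered_count (step T V c))
      + (\<sigma> * N + \<sigma> * m / 20 + (\<Sum>K<N. surplus K)))"
    using Suc.IH[OF valid_step[OF Suc.prems]] unfolding \<sigma>_def
    by (intro mean_mono) (simp add: algebra_simps)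
  then have IH: "3.05 * \<sigma> * R' \<le> b - \<sigma> / 40 * h' + (\<sigma> * N + \<sigma> * m / 20 + (\<Sum>K<N. surplus K))"
    unfolding mean_add mean_diff mean_cmult mean_const R'_def b_def h'_def .
  have fr: "b - final_rc (Suc N) T V \<le> s * (1 - 3 * \<rho>) - \<sigma> / 10 * (1 - \<beta>) * (h / m)"
    using mean_final_rc[OF Suc.prems, of N] by (simp add: b_def s_def \<rho>_def \<sigma>_def \<beta>_def h_def)
  have hm: "h / m \<le> 2"
    using half_covered_count_le[of V] m_pos by (simp add: h_def field_simps)
  have "(1 - 4 / m) * h + 2 * \<rho> \<le> h'"
    using mean_half_covered_count[OF Suc.prems] by (simp add: h_def h'_def \<rho>_def)
  then have hd: "2 * \<rho> + h - h' \<le> 4 * (h / m)"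
    by (simp add: algebra_simps)
  have "s * (1 - 3 * \<rho>) \<le> \<sigma> * (1 - 3 * \<rho>) + (s - \<sigma>)"
    using mult_nonneg_nonneg[of "s - \<sigma>" "3 * \<rho>"] \<sigma> \<rho> by (simp add: algebra_simps)
  moreover have "\<sigma> / 10 * (h / m) - \<sigma> / 5 * \<beta> \<le> \<sigma> / 10 * (1 - \<beta>) * (h / m)"
    using mult_left_mono[OF hm, of "\<sigma> / 10 * \<beta>"] \<sigma> \<beta> by (simp add: algebra_simps)
  moreover have "\<sigma> / 40 * (2 * \<rho> + h - h') \<le> \<sigma> / 10 * (h / m)"
    using mult_left_mono[OF hd, of "\<sigma> / 40"] \<sigma> by (simp add: algebra_simps)
  ultimately have "b - final_rc (Suc N) T V
    \<le> \<sigma> * (1 - 3 * \<rho>) + (s - \<sigma>) - \<sigma> / 40 * (2 * \<rho> + h - h') + \<sigma> / 5 * \<beta>"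
    using fr by linarith
  then have step: "3.05 * \<sigma> * \<rho> \<le> \<sigma> + (\<sigma> / 5 * \<beta> + s - \<sigma>) + final_rc (Suc N) T V - b - \<sigma> / 40 * h + \<sigma> / 40 * h'"
    by (simp add: algebra_simps add_divide_distrib diff_divide_distrib)
  have avg: "avg (Suc N) (roof_sum T V) / m = \<rho> + R'"
    using mean_cmult[of "1 / m" "\<lambda>c. avg N (roof_sum (Suc T) (step T V c))"]
    unfolding avg_roof_sum_Suc \<rho>_def R'_def by (simp add: add_divide_distrib)
  have sur: "(\<Sum>K<Suc N. surplus K) = (\<Sum>K<N. surplus K) + (\<sigma> / 5 * \<beta> + s - \<sigma>)"
    by (simp add: surplus_def \<sigma>_def \<beta>_def s_def)
  show ?case
    using IH step unfolding avg sur h_def[symmetric] \<sigma>_def[symmetric]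
    by (simp add: algebra_simps add_divide_distrib)
qed

lemma surplus_tendsto: "surplus \<longlonglongrightarrow> 0"
proof -
  have "(\<lambda>N. immortal_prob / 5 * miss_bound ^ N + surv_prob N - immortal_prob) \<longlonglongrightarrow>
      immortal_prob / 5 * 0 + immortal_prob - immortal_prob"
    using miss_bound by (intro tendsto_intros surv_prob_tendsto LIMSEQ_realpow_zero)
  then show ?thesis
    unfolding surplus_def[abs_def] by simp
qed

lemma sum_surplus:
  fixes e :: real
  assumes "0 < e"
  obtains A where "\<And>N. (\<Sum>K<N. surplus K) \<le> A + e * N"
proof -
  from order_tendstoD(2)[OF surplus_tendsto assms]
  obtain n where n: "\<And>K. n \<le> K \<Longrightarrow> surplus K < e"
    unfolding eventually_sequentially by blast
  have "(\<Sum>K<N. surplus K) \<le> (\<Sum>K<n. \<bar>surplus K\<bar>) + e * N" for N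
  proof -
    have "(\<Sum>K<N. surplus K) \<le> (\<Sum>K<N. (if K < n then \<bar>surplus K\<bar> else 0) + e)"
      using n assms by (intro sum_mono) (auto simp: not_less less_imp_le)
    also have "\<dots> = (\<Sum>K\<in>{..<N} \<inter> {..<n}. \<bar>surplus K\<bar>) + e * N"
      by (simp add: sum.distrib sum.inter_restrict mult.commute)
    also have "\<dots> \<le> (\<Sum>K<n. \<bar>surplus K\<bar>) + e * N"
      by (intro add_right_mono sum_mono2) auto
    finally show ?thesis .
  qed
  then show ?thesis
    using that by blast
qed

text \<open>N is chosen before the stacks, so the bound applies to whatever heap a block starts
  from.\<close>

lemma avg_roof_sum_uniform:
  obtains N where "0 < N" "\<And>T V. valid T V \<Longrightarrow> avg N (roof_sum T V) \<le> 0.3285 * m * N"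
proof -
  define \<sigma> where "\<sigma> = immortal_prob"
  have \<sigma>: "1 / 2 \<le> \<sigma>"
    using immortal_prob_ge by (simp add: \<sigma>_def)
  obtain A where A: "\<And>N. (\<Sum>K<N. surplus K) \<le> A + \<sigma> / 1000 * N"
    using sum_surplus[of "\<sigma> / 1000"] \<sigma> by auto
  \<comment> \<open>B collects the terms that do not grow with N, and a large N makes it at most
    \<sigma> / 2000 * N. Then 1 + 1 / 1000 + 1 / 2000 divided by 3.05 is below 0.3285.\<close>
  define B where "B = m + \<sigma> * m / 20 + \<bar>A\<bar>"
  obtain N where N: "B / (\<sigma> / 2000) < real N"
    using reals_Archimedean2 by blast
  have B: "0 \<le> B"
    using \<sigma> by (simp add: B_def)
  moreover from this have "0 \<le> B / (\<sigma> / 2000)"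
    using \<sigma> by (intro divide_nonneg_nonneg) auto
  ultimately have "0 < real N"
    using N by linarith
  moreover have "avg N (roof_sum T V) \<le> 0.3285 * m * N" if "valid T V" for T V
  proof -
    have "0 \<le> half_covered_count V"
      by (simp add: half_covered_count_def sum_nonneg)
    then have "0 \<le> \<sigma> / 40 * half_covered_count V"
      using \<sigma> by simp
    then have "3.05 * \<sigma> * (avg N (roof_sum T V) / m) \<le> \<sigma> * N + B + \<sigma> / 1000 * N"
      using avg_roof_sum_bound[OF that, of N] A[of N] final_rc_bounds(2)[of N T V]
      unfolding \<sigma>_def[symmetric] B_def by linarith
    also have "B \<le> \<sigma> / 2000 * N"
      using N \<sigma> by (simp add: field_simps)
    finally have "\<sigma> * (3.05 * (avg N (roof_sum T V) / m)) \<le> \<sigma> * (1.0015 * N)"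
      by (simp add: algebra_simps)
    then have "3.05 * (avg N (roof_sum T V) / m) \<le> 1.0015 * N"
      using \<sigma> by (simp only: mult_le_cancel_left_pos[of \<sigma>])
    then have "avg N (roof_sum T V) / m \<le> 0.3285 * N"
      by simp
    then show ?thesis
      using m_pos by (simp add: field_simps)
  qed
  ultimately show ?thesis
    using that by simp
qed

subsection \<open>Exponential moments\<close>

lemma roof_sum_append:
  "roof_sum T V (xs @ ys) = roof_sum T V xs + roof_sum (T + length xs) (run T V xs) ys"
  by (induction xs arbitrary: T V) auto

lemma roof_sum_nonneg: "0 \<le> roof_sum T V xs" and roof_sum_le: "roof_sum T V xs \<le> m * length xs"
proof -
  show "0 \<le> roof_sum T V xs"
    by (induction xs arbitrary: T V) (auto simp: rc_nonneg)
  show "roof_sum T V xs \<le> m * length xs"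
  proof (induction xs arbitrary: T V)
    case (Cons c xs)
    then show ?case
      using add_mono[OF rc_le[of "tops V"] Cons[of "Suc T" "step T V c"]] by (simp add: algebra_simps)
  qed simp
qed

text \<open>The normalised roof sum y of a block lies in [0, 1], so exp (\<theta> y) is at most 1 +
  \<theta> y + \<theta>^2. The mean bound holds for every initial heap, so the factors of successive
  blocks multiply.\<close>

lemma avg_exp_roof_sum:
  assumes N: "0 < N" "\<And>T V. valid T V \<Longrightarrow> avg N (roof_sum T V) \<le> 0.3285 * m * N"
    and \<theta>: "0 \<le> \<theta>" "\<theta> \<le> 1"
  shows "valid T V \<Longrightarrow> avg (n * N) (\<lambda>xs. exp (\<theta> / (m * N) * roof_sum T V xs)) \<le> (1 + \<theta> * 0.3285 + \<theta>\<^sup>2) ^ n"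
proof (induction n arbitrary: T V)
  case (Suc n)
  let ?a = "\<theta> / (m * N)"
  have mN: "0 < real m * real N"
    using N m_pos by simp
  have block: "avg N (\<lambda>xs. exp (?a * roof_sum T V xs)) \<le> 1 + \<theta> * 0.3285 + \<theta>\<^sup>2"
  proof -
    have "avg N (\<lambda>xs. exp (?a * roof_sum T V xs)) \<le> avg N (\<lambda>xs. (1 + \<theta>\<^sup>2) + ?a * roof_sum T V xs)"
    proof (rule avg_mono)
      fix xs :: "(nat \<times> sign) list" assume len: "length xs = N"
      let ?y = "roof_sum T V xs / (m * N)"
      have y: "0 \<le> ?y" "?y \<le> 1"
        using roof_sum_nonneg[of T V xs] roof_sum_le[of T V xs] len mN by (auto simp: field_simps)
      have "0 \<le> \<theta> * ?y" "\<theta> * ?y \<le> \<theta>"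
        using \<theta> y mult_left_mono[of ?y 1 \<theta>] by (auto simp del: times_divide_eq_right)
      then have "exp (\<theta> * ?y) \<le> 1 + \<theta> * ?y + (\<theta> * ?y)\<^sup>2" "(\<theta> * ?y)\<^sup>2 \<le> \<theta>\<^sup>2"
        using \<theta> by (intro exp_bound power_mono; linarith)+
      then show "exp (?a * roof_sum T V xs) \<le> (1 + \<theta>\<^sup>2) + ?a * roof_sum T V xs"
        by simp
    qed
    also have "\<dots> = (1 + \<theta>\<^sup>2) + ?a * avg N (roof_sum T V)"
      unfolding avg_add avg_cmult avg_const ..
    also have "\<dots> \<le> (1 + \<theta>\<^sup>2) + ?a * (0.3285 * m * N)"
      using N(2)[OF Suc.prems] \<theta> by (intro add_left_mono mult_left_mono) auto
    also have "\<dots> = 1 + \<theta> * 0.3285 + \<theta>\<^sup>2"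
      using N(1) m_pos by simp
    finally show ?thesis .
  qed
  have "avg (Suc n * N) (\<lambda>xs. exp (?a * roof_sum T V xs))
    = avg N (\<lambda>xs. exp (?a * roof_sum T V xs) * avg (n * N) (\<lambda>ys. exp (?a * roof_sum (T + length xs) (run T V xs) ys)))"
    unfolding mult_Suc avg_append roof_sum_append
    by (simp only: distrib_left exp_add avg_cmult)
  also have "\<dots> \<le> avg N (\<lambda>xs. (1 + \<theta> * 0.3285 + \<theta>\<^sup>2) ^ n * exp (?a * roof_sum T V xs))"
  proof (rule avg_mono)
    fix xs
    show "exp (?a * roof_sum T V xs) * avg (n * N) (\<lambda>ys. exp (?a * roof_sum (T + length xs) (run T V xs) ys))
      \<le> (1 + \<theta> * 0.3285 + \<theta>\<^sup>2) ^ n * exp (?a * roof_sum T V xs)"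
      using Suc.IH[OF valid_run[OF Suc.prems, of xs]] by (subst mult.commute) (rule mult_right_mono; simp)
  qed
  also have "\<dots> \<le> (1 + \<theta> * 0.3285 + \<theta>\<^sup>2) ^ n * (1 + \<theta> * 0.3285 + \<theta>\<^sup>2)"
    unfolding avg_cmult using \<theta> by (intro mult_left_mono block) auto
  finally show ?case
    by (simp add: mult.commute)
qed simp

text \<open>Markov's inequality for the exponential moment.\<close>

lemma roof_sum_tail:
  obtains N r where "0 < N" "0 \<le> r" "r < 1"
    "\<And>T V n. valid T V \<Longrightarrow>
      avg (n * N) (\<lambda>xs. of_bool (0.3289 * m * N * n \<le> roof_sum T V xs)) \<le> r ^ n"
proof -
  obtain N where N: "0 < N" "\<And>T V. valid T V \<Longrightarrow> avg N (roof_sum T V) \<le> 0.3285 * m * N"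
    using avg_roof_sum_uniform by blast
  \<comment> \<open>Any positive value below 0.3289 - 0.3285 = 0.0004 gives 0.3285 \<theta> +
    \<theta>^2 < 0.3289 \<theta>, hence a ratio below 1.\<close>
  define \<theta> :: real where "\<theta> = 0.0002"
  define \<kappa> where "\<kappa> = 1 + \<theta> * 0.3285 + \<theta>\<^sup>2"
  define r where "r = \<kappa> / exp (\<theta> * 0.3289)"
  have mN: "0 < real m * real N"
    using N m_pos by simp
  have \<kappa>: "0 \<le> \<kappa>"
    by (simp add: \<kappa>_def \<theta>_def)
  have "\<kappa> \<le> exp (\<theta> * 0.3285 + \<theta>\<^sup>2)"
    using exp_ge_add_one_self[of "\<theta> * 0.3285 + \<theta>\<^sup>2"] unfolding \<kappa>_def by linarith
  also have "\<dots> < exp (\<theta> * 0.3289)"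
    by (simp add: \<theta>_def power2_eq_square)
  finally have r: "0 \<le> r" "r < 1"
    using \<kappa> by (simp_all add: r_def)
  have "avg (n * N) (\<lambda>xs. of_bool (0.3289 * m * N * n \<le> roof_sum T V xs)) \<le> r ^ n"
    if v: "valid T V" for T V n
  proof -
    let ?a = "\<theta> / (m * N)"
    have a: "0 < ?a"
      using mN by (simp add: \<theta>_def)
    have "avg (n * N) (\<lambda>xs. of_bool (0.3289 * m * N * n \<le> roof_sum T V xs))
      \<le> avg (n * N) (\<lambda>xs. 1 / exp (\<theta> * 0.3289) ^ n * exp (?a * roof_sum T V xs))"
    proof (rule avg_mono)
      fix xs
      have "exp (\<theta> * 0.3289) ^ n \<le> exp (?a * roof_sum T V xs)" if "0.3289 * m * N * n \<le> roof_sum T V xs"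
      proof -
        have "exp (\<theta> * 0.3289) ^ n = exp (?a * (0.3289 * m * N * n))"
          using N(1) m_pos by (simp flip: exp_of_nat_mult add: mult.commute)
        also have "\<dots> \<le> exp (?a * roof_sum T V xs)"
          using that a by (simp only: exp_le_cancel_iff mult_le_cancel_left_pos)
        finally show ?thesis .
      qed
      then show "of_bool (0.3289 * m * N * n \<le> roof_sum T V xs)
        \<le> 1 / exp (\<theta> * 0.3289) ^ n * exp (?a * roof_sum T V xs)"
        by (auto simp: field_simps)
    qed
    also have "\<dots> \<le> 1 / exp (\<theta> * 0.3289) ^ n * \<kappa> ^ n"
      unfolding avg_cmult \<kappa>_def
      by (intro mult_left_mono avg_exp_roof_sum[OF N _ _ v]) (auto simp: \<theta>_def)
    also have "\<dots> = r ^ n"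
      by (simp add: r_def power_divide)
    finally show ?thesis .
  qed
  then show ?thesis
    using that[of N r] N(1) r by blast
qed

subsection \<open>Heaps in terms of stacks\<close>

text \<open>The map \<open>\<eta>\<close> sends time stamps to heights; it need only be increasing on pieces in
  equal or adjacent columns.\<close>

definition represents :: "nat \<Rightarrow> stacks \<Rightarrow> (nat \<Rightarrow> nat) \<Rightarrow> heap \<Rightarrow> bool" where
  "represents T V \<eta> W \<longleftrightarrow> valid T V \<and>
    W = {(\<eta> t, k, s) | t k s. k < m \<and> (t, s) \<in> set (V k)} \<and>
    (\<forall>i<m. \<forall>j\<in>{L i, i, R i}. \<forall>x\<in>set (V i). \<forall>y\<in>set (V j). fst x < fst y \<longrightarrow> \<eta> (fst x) < \<eta> (fst y)) \<and>
    (\<forall>i<m. \<forall>j<m. \<forall>x\<in>set (V i). \<forall>y\<in>set (V j). i \<noteq> j \<longrightarrow> fst x \<noteq> fst y) \<and>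
    (\<forall>i<m. \<forall>x\<in>set (V i). 1 \<le> \<eta> (fst x))"

lemma representsI:
  assumes "valid T V" "W = {(\<eta> t, k, s) | t k s. k < m \<and> (t, s) \<in> set (V k)}"
    and "\<And>i j x y. i < m \<Longrightarrow> j \<in> {L i, i, R i} \<Longrightarrow> x \<in> set (V i) \<Longrightarrow> y \<in> set (V j) \<Longrightarrow> fst x < fst y
      \<Longrightarrow> \<eta> (fst x) < \<eta> (fst y)"
    and "\<And>i j x y. i < m \<Longrightarrow> j < m \<Longrightarrow> x \<in> set (V i) \<Longrightarrow> y \<in> set (V j) \<Longrightarrow> i \<noteq> j \<Longrightarrow> fst x \<noteq> fst y"
    and "\<And>i x. i < m \<Longrightarrow> x \<in> set (V i) \<Longrightarrow> 1 \<le> \<eta> (fst x)"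
  shows "represents T V \<eta> W"
  unfolding represents_def by (intro conjI allI impI ballI) (rule assms; assumption)+

context
  fixes T V \<eta> W
  assumes rep: "represents T V \<eta> W"
begin

lemma rep_valid: "valid T V"
  and rep_heap: "(h, k, s) \<in> W \<longleftrightarrow> k < m \<and> (\<exists>t. h = \<eta> t \<and> (t, s) \<in> set (V k))"
  and rep_mono: "i < m \<Longrightarrow> j \<in> {L i, i, R i} \<Longrightarrow> x \<in> set (V i) \<Longrightarrow> y \<in> set (V j) \<Longrightarrow> fst x < fst y
    \<Longrightarrow> \<eta> (fst x) < \<eta> (fst y)"
  and rep_distinct: "i < m \<Longrightarrow> j < m \<Longrightarrow> x \<in> set (V i) \<Longrightarrow> y \<in> set (V j) \<Longrightarrow> i \<noteq> j \<Longrightarrow> fst x \<noteq> fst y"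
  and rep_pos: "i < m \<Longrightarrow> x \<in> set (V i) \<Longrightarrow> 1 \<le> \<eta> (fst x)"
  using rep unfolding represents_def by blast+

lemma rep_stamp_inject:
  assumes "k < m" "(t, s) \<in> set (V k)" "(t, s') \<in> set (V k)"
  shows "s = s'"
proof -
  have "distinct ts" if "sorted_wrt (>) ts" for ts :: "nat list"
    using that by (induction ts) auto
  then have "distinct (map fst (V k))"
    using validD(1)[OF rep_valid assms(1)] by blast
  then show ?thesis
    using assms by (metis eq_key_imp_eq_value)
qed

lemma rep_height_inject:
  assumes "k < m" "(t, s) \<in> set (V k)" "(t', s') \<in> set (V k)" "\<eta> t = \<eta> t'"
  shows "t = t'"
  using rep_mono[of k k "(t, s)" "(t', s')"] rep_mono[of k k "(t', s')" "(t, s)"] assms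
  by (cases t t' rule: linorder_cases) auto

lemma rep_hd: "V k \<noteq> [] \<Longrightarrow> (tops V k, snd (hd (V k))) \<in> set (V k)"
  by (cases "V k") (auto simp: tops_def)

lemma rep_top_height: "k < m \<Longrightarrow> top_height W k = (if V k = [] then 0 else \<eta> (tops V k))"
proof -
  assume k: "k < m"
  have *: "{h. \<exists>s. (h, k, s) \<in> W} = (\<lambda>x. \<eta> (fst x)) ` set (V k)"
    using k by (force simp: rep_heap)
  show ?thesis
  proof (cases "V k = []")
    case False
    have "\<eta> (fst x) \<le> \<eta> (tops V k)" if x: "x \<in> set (V k)" for x
    proof (cases "fst x = tops V k")
      case False
      then have "fst x < tops V k"
        using stamp_le_tops[OF rep_valid k x] by simp
      then show ?thesis
        using rep_mono[of k k x, OF k _ x rep_hd[OF \<open>V k \<noteq> []\<close>]] by simp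
    qed simp
    moreover have "\<eta> (tops V k) \<in> (\<lambda>x. \<eta> (fst x)) ` set (V k)"
      using rep_hd[OF False] by force
    ultimately show ?thesis
      using False unfolding top_height_def * by (intro Max_eqI) auto
  qed (simp add: top_height_def *)
qed

lemma rep_top_sign:
  assumes "k < m" "V k \<noteq> []"
  shows "top_sign W k = snd (hd (V k))"
  unfolding top_sign_def rep_top_height[OF assms(1)] using assms rep_hd[OF assms(2)]
  by (auto simp: rep_heap intro!: the_equality dest: rep_height_inject rep_stamp_inject)

lemma tops_empty: "V k = [] \<Longrightarrow> tops V k = 0"
  by (simp add: tops_def)

text \<open>Stamps in different columns are distinct, so monotonicity of \<eta> between adjacent
  columns works in both directions. Heights of real pieces are at least 1, which settles empty
  columns.\<close>

lemma rep_top_less: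
  assumes "i < m" "j \<in> {L i, R i}"
  shows "top_height W j < top_height W i \<longleftrightarrow> tops V j < tops V i"
proof -
  have j: "j < m" "i \<in> {L j, j, R j}" "i \<noteq> j"
    using assms by auto
  have pos: "0 < tops V k" "0 < \<eta> (tops V k)" if "V k \<noteq> []" "k < m" for k
    using validD(2)[OF rep_valid that(2) rep_hd[OF that(1)]] rep_pos[OF that(2) rep_hd[OF that(1)]] by auto
  show ?thesis
  proof (cases "V i = [] \<or> V j = []")
    case True
    then show ?thesis
      using pos assms(1) j by (auto simp: rep_top_height tops_empty)
  next
    case False
    then have ij: "(tops V i, snd (hd (V i))) \<in> set (V i)" "(tops V j, snd (hd (V j))) \<in> set (V j)"
      using rep_hd by auto
    have "tops V i \<noteq> tops V j"
      using rep_distinct[OF assms(1) j(1) ij] j(3) by simp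
    then show ?thesis
      using rep_mono[OF assms(1) _ ij] rep_mono[OF j(1,2) ij(2,1)] assms j(1) False
      by (cases "tops V i" "tops V j" rule: linorder_cases) (auto simp: rep_top_height)
  qed
qed

lemma rep_exposed:
  "k < m \<Longrightarrow> exposed (tops V) k \<longleftrightarrow> max (top_height W (L k)) (top_height W (R k)) < top_height W k"
  by (simp add: exposed_def rep_top_less)

text \<open>A removable piece is the top of its column. Equal heights in adjacent columns cannot
  occur, which reconciles the weak comparison in \<open>roof\<close> with the strict one in
  \<open>exposed\<close>.\<close>

lemma rep_roof: "roof m W = (\<lambda>k. (\<eta> (tops V k), k, snd (hd (V k)))) ` {k. k < m \<and> exposed (tops V) k}"
proof (intro set_eqI iffI)
  fix p assume p: "p \<in> roof m W"
  obtain h k s where hks: "p = (h, k, s)"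
    by (cases p)
  have W: "(h, k, s) \<in> W" and no: "\<And>h' k' s'. (h', k', s') \<in> W \<Longrightarrow> k' \<in> {L k, k, R k} \<Longrightarrow> h' \<le> h"
    using p unfolding roof_def hks by (auto simp: not_less)
  obtain t where t: "k < m" "h = \<eta> t" "(t, s) \<in> set (V k)"
    using W by (auto simp: rep_heap)
  then have ne: "V k \<noteq> []"
    by auto
  have "t = tops V k"
  proof (rule ccontr)
    assume "t \<noteq> tops V k"
    then have "t < tops V k"
      using stamp_le_tops[OF rep_valid t(1,3)] by simp
    then have "\<eta> t < \<eta> (tops V k)"
      using rep_mono[of k k, OF t(1) _ t(3) rep_hd[OF ne]] by simp
    moreover have "(\<eta> (tops V k), k, snd (hd (V k))) \<in> W"
      using t(1) rep_hd[OF ne] by (auto simp: rep_heap)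
    ultimately show False
      using no[of "\<eta> (tops V k)" k] t(2) by fastforce
  qed
  moreover have "s = snd (hd (V k))"
    using t rep_hd[OF ne] \<open>t = tops V k\<close> by (metis rep_stamp_inject)
  moreover have "tops V j < tops V k" if j: "j \<in> {L k, R k}" for j
  proof (cases "V j = []")
    case True
    then show ?thesis
      using validD(2)[OF rep_valid t(1,3)] \<open>t = tops V k\<close> by (simp add: tops_def[of V j])
  next
    case False
    have jm: "j < m" "j \<noteq> k"
      using j t(1) by auto
    have "(\<eta> (tops V j), j, snd (hd (V j))) \<in> W"
      using jm rep_hd[OF False] by (auto simp: rep_heap)
    then have le: "\<eta> (tops V j) \<le> \<eta> (tops V k)"
      using no[of "\<eta> (tops V j)" j] j t(2) \<open>t = tops V k\<close> by auto
    have "tops V j \<noteq> tops V k"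
      using rep_distinct[OF jm(1) t(1) rep_hd[OF False] rep_hd[OF ne]] jm by simp
    moreover have "\<not> tops V k < tops V j"
      using rep_mono[OF t(1) _ rep_hd[OF ne] rep_hd[OF False]] j le by auto
    ultimately show ?thesis
      by simp
  qed
  ultimately show "p \<in> (\<lambda>k. (\<eta> (tops V k), k, snd (hd (V k)))) ` {k. k < m \<and> exposed (tops V) k}"
    using t hks by (auto simp: exposed_def)
next
  fix p assume "p \<in> (\<lambda>k. (\<eta> (tops V k), k, snd (hd (V k)))) ` {k. k < m \<and> exposed (tops V) k}"
  then obtain k where k: "k < m" "exposed (tops V) k" and p: "p = (\<eta> (tops V k), k, snd (hd (V k)))"
    by auto
  have ne: "V k \<noteq> []"
    using exposed_nonempty[OF k(2)] .
  have W: "p \<in> W"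
    using k(1) rep_hd[OF ne] by (auto simp: rep_heap p)
  have "h' \<le> \<eta> (tops V k)" if W': "(h', j, s') \<in> W" and j: "j \<in> {L k, k, R k}" for h' j s'
  proof -
    obtain t where t: "j < m" "h' = \<eta> t" "(t, s') \<in> set (V j)"
      using W' by (auto simp: rep_heap)
    have kj: "k \<in> {L j, j, R j}"
      using j k(1) by auto
    have "t \<le> tops V j"
      using stamp_le_tops[OF rep_valid t(1,3)] by simp
    also have "tops V j \<le> tops V k"
      using j k(2) by (auto simp: exposed_def)
    finally have "t < tops V k \<or> t = tops V k"
      by auto
    then show ?thesis
      using rep_mono[OF t(1) kj t(3) rep_hd[OF ne]] t(2) by auto
  qed
  then show "p \<in> roof m W"
    using W unfolding roof_def p by (auto simp: not_less[symmetric])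
qed

lemma rep_card_roof: "real (card (roof m W)) = rc (tops V)"
proof -
  have "card (roof m W) = card {k. k < m \<and> exposed (tops V) k}"
    unfolding rep_roof by (rule card_image) (auto simp: inj_on_def)
  also have "{k. k < m \<and> exposed (tops V) k} = {..<m} \<inter> {k. exposed (tops V) k}"
    by auto
  finally show ?thesis
    by (simp add: rc_def)
qed

text \<open>An annihilation keeps \<eta>. A push sends the new stamp to the height given by
  \<open>drop_piece\<close>, which exceeds all heights in the three columns compared with it; pieces
  farther away may be higher.\<close>

lemma rep_drop:
  assumes k: "k < m"
  shows "\<exists>\<eta>. represents (Suc T) (step T V (k, s)) \<eta> (drop_piece m (k, s) W)"
proof (cases "exposed (tops V) k \<and> snd (hd (V k)) \<noteq> s")
  case True
  then have ne: "V k \<noteq> []"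
    using exposed_nonempty by blast
  have st: "step T V (k, s) = V(k := tl (V k))"
    using True by (simp add: step_pop)
  have drop: "drop_piece m (k, s) W = W - {(\<eta> (tops V k), k, snd (hd (V k)))}"
    using True rep_exposed[OF k] ne by (simp add: drop_piece_def Let_def rep_top_sign[OF k ne] rep_top_height[OF k])
  have tl: "(t, z) \<in> set (tl (V k)) \<longleftrightarrow> (t, z) \<in> set (V k) \<and> t \<noteq> tops V k" for t z
    using validD(1)[OF rep_valid k] ne by (cases "V k") (auto simp: tops_def)
  have sub: "set (step T V (k, s) i) \<subseteq> set (V i)" for i
    unfolding st by (cases "V k") auto
  have "W - {(\<eta> (tops V k), k, snd (hd (V k)))}
    = {(\<eta> t, i, z) | t i z. i < m \<and> (t, z) \<in> set (step T V (k, s) i)}"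
  proof (intro set_eqI)
    fix p :: piece
    obtain h i z where p: "p = (h, i, z)"
      by (cases p)
    show "p \<in> W - {(\<eta> (tops V k), k, snd (hd (V k)))} \<longleftrightarrow>
      p \<in> {(\<eta> t, i, z) | t i z. i < m \<and> (t, z) \<in> set (step T V (k, s) i)}"
    proof (cases "i = k")
      case True
      show ?thesis
        using rep_hd[OF ne] rep_height_inject[OF k] rep_stamp_inject[OF k] k
        unfolding p True st by (auto simp: rep_heap tl)
    next
      case False
      then show ?thesis
        unfolding p st by (auto simp: rep_heap)
    qed
  qed
  moreover have "\<eta> (fst x) < \<eta> (fst y)"
    if "i < m" "j \<in> {L i, i, R i}" "x \<in> set (step T V (k, s) i)" "y \<in> set (step T V (k, s) j)" "fst x < fst y"
    for i j x y
    using rep_mono[OF that(1,2) _ _ that(5)] that(3,4) sub by blast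
  moreover have "fst x \<noteq> fst y"
    if "i < m" "j < m" "x \<in> set (step T V (k, s) i)" "y \<in> set (step T V (k, s) j)" "i \<noteq> j" for i j x y
    using rep_distinct[OF that(1,2) _ _ that(5)] that(3,4) sub by blast
  moreover have "1 \<le> \<eta> (fst x)" if "i < m" "x \<in> set (step T V (k, s) i)" for i x
    using rep_pos[OF that(1)] that(2) sub by blast
  ultimately have "represents (Suc T) (step T V (k, s)) \<eta> (drop_piece m (k, s) W)"
    unfolding drop by (intro representsI valid_step[OF rep_valid])
  then show ?thesis
    by blast
next
  case False
  have st: "step T V (k, s) = V(k := (Suc T, s) # V k)"
    using False by (intro step_push) blast
  define H where "H = max (top_height W (L k)) (max (top_height W k) (top_height W (R k))) + 1"
  have drop: "drop_piece m (k, s) W = insert (H, k, s) W"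
  proof -
    have "\<not> (max (top_height W (L k)) (top_height W (R k)) < top_height W k \<and> top_sign W k \<noteq> s)"
      using False rep_exposed[OF k] rep_top_sign[OF k] exposed_nonempty[of V k] by metis
    then show ?thesis
      unfolding drop_piece_def Let_def H_def fst_conv snd_conv by (rule if_not_P)
  qed
  define \<eta>' where "\<eta>' = \<eta>(Suc T := H)"
  have old: "\<eta>' (fst x) = \<eta> (fst x)" "fst x \<noteq> Suc T" "fst x < Suc T" if "i < m" "x \<in> set (V i)" for x i
    using validD(3)[OF rep_valid that] by (auto simp: \<eta>'_def)
  have new: "\<eta>' (Suc T) = H"
    by (simp add: \<eta>'_def)
  have below: "\<eta> (fst x) < H" if j: "j \<in> {L k, k, R k}" and x: "x \<in> set (V j)" for j x
  proof -
    have jm: "j < m"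
      using j k by auto
    have "finite {h. \<exists>s. (h, j, s) \<in> W}"
    proof (rule finite_subset)
      show "{h. \<exists>s. (h, j, s) \<in> W} \<subseteq> (\<lambda>x. \<eta> (fst x)) ` set (V j)"
        by (force simp: rep_heap)
    qed simp
    moreover have "(\<eta> (fst x), j, snd x) \<in> W"
      using jm x by (force simp: rep_heap)
    ultimately have "\<eta> (fst x) \<le> top_height W j"
      unfolding top_height_def by (intro Max_ge) auto
    then show ?thesis
      using j by (auto simp: H_def)
  qed
  have mem: "x \<in> set (step T V (k, s) i) \<longleftrightarrow> x \<in> set (V i) \<or> (i = k \<and> x = (Suc T, s))" for x i
    by (auto simp: st)
  have "insert (H, k, s) W = {(\<eta>' t, i, z) | t i z. i < m \<and> (t, z) \<in> set (step T V (k, s) i)}"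
  proof (intro set_eqI)
    fix p :: piece
    obtain h i z where p: "p = (h, i, z)"
      by (cases p)
    have "p \<in> {(\<eta>' t, i, z) | t i z. i < m \<and> (t, z) \<in> set (step T V (k, s) i)} \<longleftrightarrow>
      i < m \<and> (\<exists>t. h = \<eta>' t \<and> ((t, z) \<in> set (V i) \<or> (i = k \<and> (t, z) = (Suc T, s))))"
      unfolding p mem by auto
    also have "\<dots> \<longleftrightarrow> p \<in> insert (H, k, s) W"
      unfolding p using k new old(1)[of i "(_, z)"] by (auto simp: rep_heap) metis
    finally show "p \<in> insert (H, k, s) W \<longleftrightarrow>
      p \<in> {(\<eta>' t, i, z) | t i z. i < m \<and> (t, z) \<in> set (step T V (k, s) i)}"
      by blast
  qed
  moreover have "\<eta>' (fst x) < \<eta>' (fst y)"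
    if "i < m" "j \<in> {L i, i, R i}" "x \<in> set (step T V (k, s) i)" "y \<in> set (step T V (k, s) j)" "fst x < fst y"
    for i j x y
  proof -
    have jm: "j < m"
      using that by auto
    have xi: "x \<in> set (V i)"
      using that(3-5) old(3)[OF jm, of y] by (auto simp: mem)
    show ?thesis
    proof (cases "y \<in> set (V j)")
      case True
      then show ?thesis
        using rep_mono[OF that(1,2) xi True that(5)] old(1)[OF that(1) xi] old(1)[OF jm True] by simp
    next
      case False
      then have y: "j = k" "y = (Suc T, s)"
        using that(4) by (auto simp: mem)
      then have "i \<in> {L k, k, R k}"
        using that(1,2) by auto
      then show ?thesis
        using below[OF _ xi] old(1)[OF that(1) xi] y new by simp
    qed
  qed
  moreover have "fst x \<noteq> fst y"
    if "i < m" "j < m" "x \<in> set (step T V (k, s) i)" "y \<in> set (step T V (k, s) j)" "i \<noteq> j" for i j x y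
    using that rep_distinct[of i j x y] old(2)[of i x] old(2)[of j y] by (auto simp: mem)
  moreover have "1 \<le> \<eta>' (fst x)" if "i < m" "x \<in> set (step T V (k, s) i)" for i x
    using that rep_pos[of i x] old(1)[of i x] new by (auto simp: mem H_def)
  ultimately have "represents (Suc T) (step T V (k, s)) \<eta>' (drop_piece m (k, s) W)"
    unfolding drop by (intro representsI valid_step[OF rep_valid])
  then show ?thesis
    by blast
qed

end

section \<open>The stack process and the roof counts of the heap process\<close>

definition process :: "(nat \<Rightarrow> nat \<times> sign) \<Rightarrow> nat \<Rightarrow> stacks" where
  "process c n = run 0 (\<lambda>_. []) (map c [0..<n])"

lemma valid_empty: "valid 0 (\<lambda>_. [])"
  by (simp add: valid_def)

lemma process_Suc: "process c (Suc n) = step n (process c n) (c n)"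
  by (simp add: process_def run_append)

lemma represents_process:
  assumes "\<And>i. fst (c i) < m"
  shows "\<exists>\<eta>. represents n (process c n) \<eta> (heap_process m c n)"
proof (induction n)
  case 0
  then show ?case
    by (auto simp: represents_def process_def valid_def)
next
  case (Suc n)
  then obtain \<eta> where "represents n (process c n) \<eta> (heap_process m c n)"
    by blast
  from rep_drop[OF this assms, of n "snd (c n)"] show ?case
    by (simp add: process_Suc)
qed

lemma roof_sum_process: "roof_sum 0 (\<lambda>_. []) (map c [0..<n]) = (\<Sum>k<n. rc (tops (process c k)))"
  by (induction n) (auto simp: roof_sum_append process_def)

text \<open>\<open>roof_sum\<close> counts the roof before each drop, that is at times 0 to n for
  \<open>Suc n\<close> drops; time 0 is added on the right.\<close>

lemma sum_card_roof_le:
  assumes "\<And>i. fst (c i) < m"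
  shows "(\<Sum>k=1..n. real (card (roof m (heap_process m c k)))) \<le> roof_sum 0 (\<lambda>_. []) (map c [0..<Suc n])"
proof -
  have "real (card (roof m (heap_process m c k))) = rc (tops (process c k))" for k
  proof -
    obtain \<eta> where "represents k (process c k) \<eta> (heap_process m c k)"
      using represents_process[of c k] assms by blast
    then show ?thesis
      by (rule rep_card_roof)
  qed
  then have "(\<Sum>k=1..n. real (card (roof m (heap_process m c k)))) = (\<Sum>k=1..n. rc (tops (process c k)))"
    by simp
  also have "\<dots> \<le> (\<Sum>k<Suc n. rc (tops (process c k)))"
    by (rule sum_mono2) (auto simp: rc_nonneg)
  finally show ?thesis
    by (simp only: roof_sum_process)
qed

end

subsection \<open>The probability space\<close>

context prob_space
begin

lemma uniform_choices_prob:
  assumes "cyclic_columns m" "uniform_choices m M c"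
  shows "random_variable (count_space UNIV) (c n)"
    "AE \<omega> in M. c n \<omega> \<in> cyclic_columns.choices m"
    "a \<in> cyclic_columns.choices m \<Longrightarrow> prob (c n -` {a} \<inter> space M) = 1 / (2 * real m)"
proof -
  interpret cyclic_columns m by fact
  show meas: "random_variable (count_space UNIV) (c n)"
    using assms(2) unfolding uniform_choices_def indep_vars_def by blast
  have distr: "distr M (count_space UNIV) (c n) = measure_pmf (pmf_of_set choices)"
    using assms(2) unfolding uniform_choices_def choices_def by blast
  have ne: "choices \<noteq> {}"
    using card_choices four_le_m by force
  have "AE x in distr M (count_space UNIV) (c n). x \<in> choices"
    unfolding distr using AE_measure_pmf[of "pmf_of_set choices"] set_pmf_of_set[OF ne] by simp
  then show "AE \<omega> in M. c n \<omega> \<in> choices"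
    by (subst (asm) AE_distr_iff[OF meas]) auto
  have "prob (c n -` {a} \<inter> space M) = 1 / (2 * real m)" if a: "a \<in> choices" for a
  proof -
    have "prob (c n -` {a} \<inter> space M) = measure (distr M (count_space UNIV) (c n)) {a}"
      by (rule measure_distr[symmetric, OF meas]) simp
    also have "\<dots> = 1 / (2 * real m)"
      unfolding distr using a ne by (simp add: measure_pmf_single card_choices)
    finally show ?thesis .
  qed
  then show "a \<in> choices \<Longrightarrow> prob (c n -` {a} \<inter> space M) = 1 / (2 * real m)" .
qed

text \<open>Up to a null set the event is a finite disjoint union of cylinders, each of probability
  \<open>1 / (2 * m) ^ n\<close> by independence.\<close>

lemma prob_list_event:
  assumes "cyclic_columns m" "uniform_choices m M c"
  shows "{\<omega> \<in> space M. Q (map (\<lambda>i. c i \<omega>) [0..<n])} \<in> events"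
    "prob {\<omega> \<in> space M. Q (map (\<lambda>i. c i \<omega>) [0..<n])} = cyclic_columns.avg m n (\<lambda>xs. of_bool (Q xs))"
proof -
  interpret cyclic_columns m by fact
  note u = uniform_choices_prob[OF assms]
  define A where "A xs = {\<omega> \<in> space M. map (\<lambda>i. c i \<omega>) [0..<n] = xs}" for xs
  have A_eq: "A xs = {\<omega> \<in> space M. \<forall>i<n. c i \<omega> = xs ! i}" if "length xs = n" for xs
    using that unfolding A_def by (auto simp: list_eq_iff_nth_eq)
  have meas_eq: "{\<omega> \<in> space M. c i \<omega> = a} \<in> events" for i a
    using measurable_sets[OF u(1), of "{a}" i] by (simp add: vimage_def Int_def conj_commute)
  have A_meas: "A xs \<in> events" for xs
  proof (cases "length xs = n")
    case True
    show ?thesis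
      unfolding A_eq[OF True] by (intro sets.sets_Collect_finite_All' sets.sets_Collect_countable_All meas_eq sets.sets_Collect) 
  next
    case False
    then have "A xs = {}"
      by (auto simp: A_def)
    then show ?thesis
      by simp
  qed
  have ev: "{\<omega> \<in> space M. Q (map (\<lambda>i. c i \<omega>) [0..<n])} = (\<Union>xs\<in>{xs. Q xs}. A xs)"
    by (auto simp: A_def)
  show meas: "{\<omega> \<in> space M. Q (map (\<lambda>i. c i \<omega>) [0..<n])} \<in> events"
    unfolding ev
  proof (intro sets.countable_UN'' A_meas)
    have "UNIV = UNIV \<times> {Plus, Minus}"
      using sign.exhaust by auto
    then have "countable (UNIV :: (nat \<times> sign) set)"
      by (metis countable_SIGMA countable_finite countableI_type finite.emptyI finite_insert)
    then have "countable (lists (UNIV :: (nat \<times> sign) set))"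
      by (rule countable_lists)
    then show "countable {xs. Q xs}"
      by (rule countable_subset[rotated]) auto
  qed
  let ?S = "{xs. length xs = n \<and> set xs \<subseteq> choices}"
  have finS: "finite ?S"
    using finite_lists_length_eq[OF finite_choices, of n] by (simp add: conj_commute)
  have probA: "prob (A xs) = 1 / (2 * m) ^ n" if xs: "xs \<in> ?S" for xs
  \<comment> \<open>For n = 0 the cylinder is the whole space; the product formula for independent
    events needs a nonempty index set.\<close>
  proof (cases "n = 0")
    case True
    then have "A xs = space M"
      using xs by (auto simp: A_def)
    then show ?thesis
      using True prob_space by simp
  next
    case False
    have "A xs = (\<Inter>i\<in>{..<n}. c i -` {xs ! i} \<inter> space M)"
      using A_eq[of xs] xs False by auto
    also have "prob \<dots> = (\<Prod>i<n. prob (c i -` {xs ! i} \<inter> space M))"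
      using assms(2) False unfolding uniform_choices_def by (intro indep_varsD[of _ _ UNIV]) auto
    also have "\<dots> = (\<Prod>i<n. 1 / (2 * real m))"
    proof (intro prod.cong refl u(3))
      fix i assume "i \<in> {..<n}"
      then show "xs ! i \<in> choices"
        using xs nth_mem[of i xs] by blast
    qed
    finally show ?thesis
      by (simp add: power_divide)
  qed
  have ae: "AE \<omega> in M. \<forall>i. c i \<omega> \<in> choices"
    using u(2) by (simp add: AE_all_countable)
  have "prob {\<omega> \<in> space M. Q (map (\<lambda>i. c i \<omega>) [0..<n])} = prob (\<Union>xs\<in>?S \<inter> {xs. Q xs}. A xs)"
  proof (intro finite_measure_eq_AE meas)
    show "(\<Union>xs\<in>?S \<inter> {xs. Q xs}. A xs) \<in> events"
      using finS A_meas by (intro sets.finite_UN) auto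
    show "AE \<omega> in M. \<omega> \<in> {\<omega> \<in> space M. Q (map (\<lambda>i. c i \<omega>) [0..<n])} \<longleftrightarrow>
      \<omega> \<in> (\<Union>xs\<in>?S \<inter> {xs. Q xs}. A xs)"
      using ae by eventually_elim (auto simp: A_def)
  qed
  also have "\<dots> = (\<Sum>xs\<in>?S \<inter> {xs. Q xs}. prob (A xs))"
    using finS A_meas by (intro finite_measure_finite_Union) (auto simp: disjoint_family_on_def A_def)
  also have "\<dots> = (\<Sum>xs\<in>?S \<inter> {xs. Q xs}. 1 / (2 * m) ^ n)"
    by (intro sum.cong probA) auto
  also have "\<dots> = avg n (\<lambda>xs. of_bool (Q xs))"
    unfolding avg_eq_sum using finS by (simp add: sum_of_bool_eq)
  finally show "prob {\<omega> \<in> space M. Q (map (\<lambda>i. c i \<omega>) [0..<n])} = avg n (\<lambda>xs. of_bool (Q xs))" .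
qed

end

theorem mainTheorem2:
  fixes m :: nat and M :: "'a measure" and c :: "nat \<Rightarrow> 'a \<Rightarrow> nat \<times> sign"
    and W :: "nat \<Rightarrow> 'a \<Rightarrow> heap"
  assumes "m \<ge> 4"
    and "prob_space M"
    and "uniform_choices m M c"
    and "\<And>n \<omega>. W n \<omega> = heap_process m (\<lambda>i. c i \<omega>) n"
  shows "AE \<omega> in M.
    limsup (\<lambda>n. ereal (1 / (real m * real n) * (\<Sum>k=1..n. real (card (roof m (W k \<omega>))))))
      \<le> ereal 0.32893"
proof -
  interpret cyclic_columns m
    by unfold_locales (fact assms(1))
  interpret prob_space M by fact
  have cc: "cyclic_columns m"
    by unfold_locales
  obtain N r where N: "0 < N" and r: "0 \<le> r" "r < 1" and
    tail: "\<And>T V n. valid T V \<Longrightarrow> avg (n * N) (\<lambda>xs. of_bool (0.3289 * m * N * n \<le> roof_sum T V xs)) \<le> r ^ n"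
    using roof_sum_tail by blast
  let ?D = "\<lambda>\<omega> n. roof_sum 0 (\<lambda>_. []) (map (\<lambda>i. c i \<omega>) [0..<n])"
  \<comment> \<open>The tail bound concerns whole blocks, hence only the times
    \<open>n * N\<close>.\<close>
  let ?B = "\<lambda>n. {\<omega> \<in> space M. 0.3289 * m * N * n \<le> ?D \<omega> (n * N)}"
  have "AE \<omega> in M. eventually (\<lambda>n. \<omega> \<in> space M - ?B n) sequentially"
  proof (rule borel_cantelli_AE1)
    show "?B n \<in> events" for n
      by (rule prob_list_event(1)[OF cc assms(3), where Q = "\<lambda>xs. 0.3289 * m * N * n \<le> roof_sum 0 (\<lambda>_. []) xs"])
    show "emeasure M (?B n) < \<infinity>" for n
      by (simp add: less_top[symmetric])
    have "prob (?B n) \<le> r ^ n" for n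
      unfolding prob_list_event(2)[OF cc assms(3), where Q = "\<lambda>xs. 0.3289 * m * N * n \<le> roof_sum 0 (\<lambda>_. []) xs"]
      by (rule tail[OF valid_empty])
    then show "summable (\<lambda>n. prob (?B n))"
      using r by (intro summable_comparison_test[OF _ summable_geometric[of r]]) auto
  qed
  moreover have "AE \<omega> in M. \<forall>i. c i \<omega> \<in> choices"
    using uniform_choices_prob(2)[OF cc assms(3)] by (simp add: AE_all_countable)
  ultimately show ?thesis
  proof eventually_elim
    case (elim \<omega>)
    let ?c = "\<lambda>i. c i \<omega>"
    have c: "fst (?c i) < m" for i
      using elim(2) by (auto intro: fst_choices)
    obtain n0 where n0: "\<And>n. n0 \<le> n \<Longrightarrow> ?D \<omega> (n * N) < 0.3289 * m * N * n"
      using elim(1) unfolding eventually_sequentially by (auto simp: not_le)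
    \<comment> \<open>Roof sums increase with time, so a time between two multiples of N is
      controlled by the next multiple.\<close>
    have mono: "?D \<omega> n \<le> ?D \<omega> n'" if "n \<le> n'" for n n'
      unfolding roof_sum_process using that by (intro sum_mono2) (auto simp: rc_nonneg)
    \<comment> \<open>Rounding up to whole blocks replaces n by at most n + N. The loss 0.3289 N is
      at most 0.00003 n once n is at least 10964 N, and 11000 is a round value above this.\<close>
    have "1 / (real m * real n) * (\<Sum>k=1..n. real (card (roof m (W k \<omega>)))) \<le> 0.32893"
      if n: "n0 * N + 11000 * N \<le> n" for n
    proof -
      let ?L = "n div N + 1"
      have n_pos: "0 < n"
        using n N by simp
      have "n0 \<le> n div N"
        using n N by (metis add_leD1 div_le_mono nonzero_mult_div_cancel_right not_gr_zero)
      have "Suc n \<le> ?L * N"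
        using N by (simp add: Suc_le_eq dividend_less_div_times)
      have "(\<Sum>k=1..n. real (card (roof m (W k \<omega>)))) \<le> ?D \<omega> (Suc n)"
        unfolding assms(4) by (rule sum_card_roof_le[OF c])
      also have "\<dots> \<le> ?D \<omega> (?L * N)"
        by (rule mono) fact
      also have "\<dots> \<le> 0.3289 * m * N * ?L"
        using n0[of ?L] \<open>n0 \<le> n div N\<close> by simp
      also have "\<dots> = 0.3289 * m * real (N * (n div N) + N)"
        by (simp add: algebra_simps)
      also have "\<dots> \<le> 0.3289 * m * (n + N)"
        by (intro mult_left_mono of_nat_mono) auto
      also have "\<dots> \<le> m * (0.32893 * n)"
      proof -
        have "11000 * real N \<le> n"
          using n by (metis add_leD2 of_nat_le_iff of_nat_mult of_nat_numeral)
        then have "0.3289 * (n + N) \<le> 0.32893 * n"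
          by (simp add: algebra_simps)
        from mult_left_mono[OF this, of "real m"] show ?thesis
          by (simp add: algebra_simps)
      qed
      finally show ?thesis
        using n_pos m_pos by (simp add: field_simps)
    qed
    then have "eventually (\<lambda>n. ereal (1 / (real m * real n) * (\<Sum>k=1..n. real (card (roof m (W k \<omega>))))) \<le> ereal 0.32893) sequentially"
      unfolding eventually_sequentially by (intro exI[of _ "n0 * N + 11000 * N"]) simp
    then show ?case
      by (rule Limsup_bounded)
  qed
qed

end
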